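(* Let $d\ge1$ and let $\mathcal{A}=(A_n)_{n\in\mathbb{N}}$ be a sequence of integral $d\times d$ matrices such that $\det(A_m-A_n)\ne0$ for all $m,n\in\mathbb{N}$ with $m\ne n$. Let $\tau_1,\ldots,\tau_d>0$ with $\sum_{i=1}^d\tau_i>1$, and let $\mathbf{r}=(r_1,\ldots,r_d)$ with $r_i(n)=n^{-\tau_i}$ for $1\le i\le d$ and $n\in\mathbb{N}$. Then for Lebesgue almost all $\boldsymbol\alpha\in[0,1)^d$, $$\dim_{\rm H}\mathcal{T}_{\boldsymbol\alpha}(\mathcal{A},\mathbf{r})=\min_{1\le i\le d}\left\{\frac{1+\sum_{j\colon\tau_j<\tau_i}(\tau_i-\tau_j)}{\tau_i}\right\}.$$
   Context: $\mathbb{N}=\{1,2,\ldots\}$. $\dim_{\rm H}$ denotes Hausdorff dimension. $\|x\|$ denotes the distance from a real number $x$ to the nearest integer. $\mathcal{R}_n(\mathbf{r})=\{\mathbf{x}\in[0,1)^d:\|x_i\|\le r_i(n),\ 1\le i\le d\}$, and $$\mathcal{T}_{\boldsymbol\alpha}(\mathcal{A},\mathbf{r})=\{\boldsymbol\beta\in[0,1)^d: A_n\boldsymbol\alpha\in\boldsymbol\beta+\mathcal{R}_n(\mathbf{r})\ (\mathrm{mod}\ 1)\text{ for infinitely many } n\in\mathbb{N}\},$$ i.e. $\boldsymbol\beta$ belongs to this set iff for infinitely many $n$ one has $\|(A_n\boldsymbol\alpha)_i-\beta_i\|\le r_i(n)$ for all $1\le i\le d$. *)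

theory Defs
  imports "HOL-Analysis.Analysis"
begin

section \<open>Hausdorff measure and Hausdorff dimension\<close>

text \<open>The contribution \<open>|U|^s\<close> of one covering set. The case \<open>s = 0\<close> is separated because
  \<open>0 powr 0 = 0\<close>, whereas the usual convention is that nonempty sets contribute 1.\<close>

definition hausdorff_gauge :: "real \<Rightarrow> 'a::metric_space set \<Rightarrow> real" where
  "hausdorff_gauge s U =
     (if U = {} then 0 else if s = 0 then 1 else diameter U powr s)"

text \<open>Boundedness of the covering sets is required explicitly, since the value of
  \<^const>\<open>diameter\<close> is meaningless on unbounded sets. Finite covers are included, as
  covering sets may be empty.\<close>

definition hausdorff_premeasure :: "real \<Rightarrow> real \<Rightarrow> 'a::metric_space set \<Rightarrow> ennreal" where
  "hausdorff_premeasure s \<delta> E =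
     (INF U \<in> {U :: nat \<Rightarrow> 'a set. E \<subseteq> (\<Union>k. U k) \<and> (\<forall>k. bounded (U k) \<and> diameter (U k) \<le> \<delta>)}.
        \<Sum>k. ennreal (hausdorff_gauge s (U k)))"

definition hausdorff_measure :: "real \<Rightarrow> 'a::metric_space set \<Rightarrow> ennreal" where
  "hausdorff_measure s E = (SUP \<delta> \<in> {0<..}. hausdorff_premeasure s \<delta> E)"

text \<open>The value is \<open>\<infinity>\<close> if no \<open>s\<close> qualifies; the empty set has dimension 0.\<close>

definition hausdorff_dim :: "'a::metric_space set \<Rightarrow> ereal" where
  "hausdorff_dim E = Inf {ereal s | s. 0 \<le> s \<and> hausdorff_measure s E = 0}"

section \<open>The limsup sets\<close>

definition unit_cube :: "(real ^ 'n) set" where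
  "unit_cube = {x. \<forall>i. 0 \<le> x $ i \<and> x $ i < 1}"

definition dist_nearest_int :: "real \<Rightarrow> real" where
  "dist_nearest_int x = infdist x \<int>"

definition int_mat_apply :: "int ^ 'n ^ 'm \<Rightarrow> real ^ 'n \<Rightarrow> real ^ 'm" where
  "int_mat_apply M x = (\<chi> i j. real_of_int (M $ i $ j)) *v x"

definition target_box :: "('n \<Rightarrow> nat \<Rightarrow> real) \<Rightarrow> nat \<Rightarrow> (real ^ 'n) set" where
  "target_box r n = {x \<in> unit_cube. \<forall>i. dist_nearest_int (x $ i) \<le> r i n}"

definition cong_mod_1 :: "real ^ 'n \<Rightarrow> real ^ 'n \<Rightarrow> bool" where
  "cong_mod_1 x y \<longleftrightarrow> (\<forall>i. x $ i - y $ i \<in> \<int>)"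

definition shrinking_target_set ::
    "real ^ 'n \<Rightarrow> (nat \<Rightarrow> int ^ 'n ^ 'n) \<Rightarrow> ('n \<Rightarrow> nat \<Rightarrow> real) \<Rightarrow> (real ^ 'n) set" where
  "shrinking_target_set \<alpha> A r =
     {\<beta> \<in> unit_cube. infinite {n. 1 \<le> n \<and>
        (\<exists>x \<in> target_box r n. cong_mod_1 (int_mat_apply (A n) \<alpha>) (\<beta> + x))}}"

lemma dist_nearest_int_le_iff:
  "dist_nearest_int x \<le> c \<longleftrightarrow> (\<exists>k::int. \<bar>x - of_int k\<bar> \<le> c)"
proof
  have "closed (\<int> :: real set)" by (rule closed_Ints)
  moreover have "(\<int> :: real set) \<noteq> {}" using Ints_0 by blast
  ultimately obtain k where k: "k \<in> \<int>" "infdist x \<int> = dist x k"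
    by (rule infdist_attains_inf)
  assume "dist_nearest_int x \<le> c"
  with k show "\<exists>k::int. \<bar>x - of_int k\<bar> \<le> c"
    by (auto simp: dist_nearest_int_def dist_real_def elim!: Ints_cases)
next
  assume "\<exists>k::int. \<bar>x - of_int k\<bar> \<le> c"
  then obtain k :: int where "dist x (of_int k) \<le> c" by (auto simp: dist_real_def)
  then show "dist_nearest_int x \<le> c"
    unfolding dist_nearest_int_def using infdist_le[of "of_int k" \<int> x] by auto
qed

lemma dist_nearest_int_cong:
  assumes "x - y \<in> \<int>"
  shows "dist_nearest_int x = dist_nearest_int y"
proof -
  have le: "dist_nearest_int v \<le> dist_nearest_int u" if "u - v \<in> \<int>" for u v
  proof -
    from that obtain m :: int where m: "u - v = of_int m" by (auto elim: Ints_cases)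
    obtain k :: int where "\<bar>u - of_int k\<bar> \<le> dist_nearest_int u"
      using dist_nearest_int_le_iff[of u "dist_nearest_int u"] by auto
    moreover have "v - of_int (k - m) = u - of_int k" using m by simp
    ultimately show ?thesis unfolding dist_nearest_int_le_iff by metis
  qed
  have "y - x \<in> \<int>" using assms Ints_minus[of "x - y"] by simp
  with assms le show ?thesis by (meson order_antisym)
qed

lemma mem_shrinking_target_set_iff:
  "\<beta> \<in> shrinking_target_set \<alpha> A r \<longleftrightarrow>
     \<beta> \<in> unit_cube \<and>
     infinite {n. 1 \<le> n \<and>
       (\<forall>i. dist_nearest_int (int_mat_apply (A n) \<alpha> $ i - \<beta> $ i) \<le> r i n)}"
proof -
  have "(\<exists>x \<in> target_box r n. cong_mod_1 y (\<beta> + x)) \<longleftrightarrow>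
        (\<forall>i. dist_nearest_int (y $ i - \<beta> $ i) \<le> r i n)" (is "?L \<longleftrightarrow> ?R") for y n
  proof
    assume ?L
    then obtain x where x: "x \<in> target_box r n" "cong_mod_1 y (\<beta> + x)" by blast
    show ?R
    proof
      fix i
      have "(y $ i - \<beta> $ i) - x $ i \<in> \<int>"
        using x(2) by (simp add: cong_mod_1_def diff_diff_add)
      from dist_nearest_int_cong[OF this] x(1)
      show "dist_nearest_int (y $ i - \<beta> $ i) \<le> r i n" by (simp add: target_box_def)
    qed
  next
    assume R: ?R
    define x where "x = (\<chi> i. frac (y $ i - \<beta> $ i))"
    have Z: "(y $ i - \<beta> $ i) - x $ i \<in> \<int>" for i
      by (simp add: x_def frac_def)
    have "x \<in> target_box r n"
      using R dist_nearest_int_cong[OF Z]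
      by (simp add: target_box_def unit_cube_def x_def frac_lt_1)
    moreover have "cong_mod_1 y (\<beta> + x)"
      using Z by (simp add: cong_mod_1_def diff_diff_add)
    ultimately show ?L by blast
  qed
  then show ?thesis by (simp add: shrinking_target_set_def)
qed

end

theory Submission
  imports Defs
begin

text \<open>The upper bound holds for every \<open>\<alpha>\<close>. The \<open>n\<close>-th target is a box with sides \<open>2 n\<^sup>-\<^sup>\<tau>\<^sup>j\<close>; for a
  fixed \<open>i\<close> it is covered by a constant times \<open>\<Prod>j. max 1 (n powr (\<tau> i - \<tau> j))\<close> cubes of side
  \<open>n powr (- \<tau> i)\<close>, and the resulting series \<open>\<Sum>n. n powr ((\<Sum>j. max 0 (\<tau> i - \<tau> j)) - \<tau> i * s)\<close>
  converges as soon as \<open>s\<close> exceeds the \<open>i\<close>-th term of the minimum.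

  For the lower bound, add a random shift \<open>x\<close> and consider the points \<open>x + A k \<alpha>\<close> of the torus.
  As \<open>A k - A l\<close> has nonzero determinant, it acts on the torus as a surjective, hence measure
  preserving, endomorphism (\<open>nn_integral_cube_int_mat_apply\<close>). Consequently the points
  \<open>x + A k \<alpha>\<close>, for random \<open>x\<close> and \<open>\<alpha>\<close>, are uniformly distributed and pairwise independent.
  Since \<open>x\<close> only translates the limsup set, it does not affect Hausdorff measure.

  Pairwise independence suffices for a second moment argument. The indices are grouped into
  blocks from \<open>2\<^sup>n\<close> to \<open>2\<^sup>n\<^sup>+\<^sup>1\<close>; each target of a block is replaced by a dyadic box inside it,
  and the block gets the density \<open>g n\<close> that distributes mass evenly over these \<open>2\<^sup>n\<close> boxes. The
  distance of \<open>g n\<close> from Lebesgue measure is measured by the sum over all dyadic cubes \<open>Q\<close> of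
  \<open>2 powr (s * m) * (\<integral>Q. g n - 1)\<^sup>2\<close>, where \<open>m\<close> is the level of \<open>Q\<close>. This is a discrete form of the
  \<open>s\<close>-energy. In its expected value all products of two different boxes cancel, and there remains
  \<open>2\<^sup>-\<^sup>n\<close> times the energy of a single box, which decays exponentially if \<open>s\<close> is less than the
  minimum (\<open>critical_exponent_mult_le\<close>, \<open>nn_integral_energy\<close>). So for almost all \<open>\<alpha>\<close> there is a
  shift for which the energies are summable.

  The rest is deterministic. If the energies tend to \<open>0\<close>, then products of densities \<open>g n\<close> along a
  sparse sequence of blocks keep their mass and have bounded norms, while their supports shrink to
  a subset of the limsup set (\<open>hausdorff_measure_intersection_pos\<close>). A bound on the norms implies
  that this subset has positive \<open>s\<close>-dimensional measure, by the Cauchy--Schwarz inequality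
  (\<open>hausdorff_measure_pos_of_dyadic_norm\<close>).\<close>

section \<open>Hausdorff measure\<close>

lemma hausdorff_gauge_nonneg: "0 \<le> hausdorff_gauge s U"
  by (simp add: hausdorff_gauge_def)

lemma hausdorff_gauge_antimono:
  assumes "0 \<le> s" "s \<le> t" "bounded U" "diameter U \<le> 1"
  shows "hausdorff_gauge t U \<le> hausdorff_gauge s U"
  using assms diameter_ge_0[of U] powr_mono'[of s t "diameter U"]
  by (auto simp: hausdorff_gauge_def powr_le1)

lemma hausdorff_premeasure_le:
  assumes "E \<subseteq> (\<Union>k. U k)" "\<And>k. bounded (U k)" "\<And>k. diameter (U k) \<le> \<delta>"
  shows "hausdorff_premeasure s \<delta> E \<le> (\<Sum>k. ennreal (hausdorff_gauge s (U k)))"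
  unfolding hausdorff_premeasure_def by (rule INF_lower) (use assms in auto)

lemma hausdorff_premeasure_antimono:
  "\<delta> \<le> \<delta>' \<Longrightarrow> hausdorff_premeasure s \<delta>' E \<le> hausdorff_premeasure s \<delta> E"
  unfolding hausdorff_premeasure_def
  by (rule INF_superset_mono) (auto intro: order_trans)

lemma hausdorff_measure_eq_0_iff:
  "hausdorff_measure s E = 0 \<longleftrightarrow> (\<forall>\<delta>>0. hausdorff_premeasure s \<delta> E = 0)"
proof
  assume L: "hausdorff_measure s E = 0"
  show "\<forall>\<delta>>0. hausdorff_premeasure s \<delta> E = 0"
  proof (intro allI impI)
    fix \<delta> :: real assume "\<delta> > 0"
    then have "hausdorff_premeasure s \<delta> E \<le> hausdorff_measure s E"
      unfolding hausdorff_measure_def by (intro SUP_upper) auto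
    then show "hausdorff_premeasure s \<delta> E = 0" using L by simp
  qed
next
  assume R: "\<forall>\<delta>>0. hausdorff_premeasure s \<delta> E = 0"
  have "hausdorff_measure s E \<le> 0"
    unfolding hausdorff_measure_def by (rule SUP_least) (use R in auto)
  then show "hausdorff_measure s E = 0" by simp
qed

lemma hausdorff_measure_null_mono:
  assumes "0 \<le> s" "s \<le> t" "hausdorff_measure s E = 0"
  shows "hausdorff_measure t E = 0"
proof -
  have "hausdorff_premeasure t \<delta> E = 0" if "\<delta> > 0" for \<delta>
  proof -
    have "hausdorff_premeasure t \<delta> E \<le> hausdorff_premeasure t (min 1 \<delta>) E"
      by (rule hausdorff_premeasure_antimono) simp
    also have "\<dots> \<le> hausdorff_premeasure s (min 1 \<delta>) E"
      unfolding hausdorff_premeasure_def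
      by (intro INF_mono) (auto intro!: suminf_le ennreal_leI hausdorff_gauge_antimono assms)
    also have "\<dots> = 0" using assms(3) that by (simp add: hausdorff_measure_eq_0_iff)
    finally show ?thesis by simp
  qed
  then show ?thesis by (simp add: hausdorff_measure_eq_0_iff)
qed

lemma hausdorff_measure_null_subset:
  assumes "E \<subseteq> F" "hausdorff_measure s F = 0"
  shows "hausdorff_measure s E = 0"
proof -
  have "hausdorff_premeasure s \<delta> E \<le> hausdorff_premeasure s \<delta> F" for \<delta>
    unfolding hausdorff_premeasure_def
    by (rule INF_superset_mono) (use assms(1) in auto)
  then show ?thesis using assms(2) unfolding hausdorff_measure_eq_0_iff by (metis le_zero_eq)
qed

lemma diameter_translation:
  fixes S :: "'a::real_normed_vector set"
  shows "diameter ((+) t ` S) = diameter S"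
proof -
  have "(\<lambda>(x,y). dist x y) ` ((+) t ` S \<times> (+) t ` S) = (\<lambda>(x,y). dist x y) ` (S \<times> S)"
    by (force simp: image_iff)
  then show ?thesis by (simp add: diameter_def)
qed

lemma hausdorff_measure_null_translation:
  fixes E :: "'a::real_normed_vector set"
  assumes "hausdorff_measure s E = 0"
  shows "hausdorff_measure s ((+) t ` E) = 0"
proof -
  have "hausdorff_premeasure s \<delta> ((+) t ` E) \<le> hausdorff_premeasure s \<delta> E" for \<delta>
    unfolding hausdorff_premeasure_def[of _ _ E]
  proof (rule INF_greatest, clarify)
    fix U :: "nat \<Rightarrow> 'a set"
    assume U: "E \<subseteq> (\<Union>k. U k)" "\<forall>k. bounded (U k) \<and> diameter (U k) \<le> \<delta>"
    have "hausdorff_premeasure s \<delta> ((+) t ` E)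
        \<le> (\<Sum>k. ennreal (hausdorff_gauge s ((+) t ` U k)))"
    proof (rule hausdorff_premeasure_le)
      show "(+) t ` E \<subseteq> (\<Union>k. (+) t ` U k)" using U(1) by blast
    qed (use U in \<open>auto simp: diameter_translation intro: bounded_translation\<close>)
    then show "hausdorff_premeasure s \<delta> ((+) t ` E) \<le> (\<Sum>k. ennreal (hausdorff_gauge s (U k)))"
      by (simp add: hausdorff_gauge_def diameter_translation cong: if_cong)
  qed
  then show ?thesis using assms unfolding hausdorff_measure_eq_0_iff by (metis le_zero_eq)
qed

section \<open>The upper bound\<close>

text \<open>Each point of \<open>E\<close> lies in members of \<open>C n\<close> for arbitrarily late \<open>n\<close>, so the families \<open>C n\<close> with
  \<open>n \<ge> N\<close> form a cover of \<open>E\<close>, at the cost of a tail of a convergent series.\<close>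

lemma hausdorff_measure_limsup_null:
  fixes C :: "nat \<Rightarrow> 'a::metric_space set set"
  assumes s: "0 < s"
    and fin: "\<And>n. finite (C n)"
    and bdd: "\<And>n U. U \<in> C n \<Longrightarrow> bounded U \<and> diameter U \<le> d n"
    and card: "\<And>n. real (card (C n)) \<le> c n"
    and lim: "d \<longlonglongrightarrow> 0"
    and summ: "summable (\<lambda>n. c n * d n powr s)"
    and E: "\<And>x. x \<in> E \<Longrightarrow> infinite {n. x \<in> \<Union>(C n)}"
  shows "hausdorff_measure s E = 0"
  unfolding hausdorff_measure_eq_0_iff
proof (intro allI impI)
  fix \<delta> :: real assume \<delta>: "\<delta> > 0"
  have "hausdorff_premeasure s \<delta> E \<le> 0 + ennreal \<epsilon>" if \<epsilon>: "\<epsilon> > 0" for \<epsilon>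
  proof -
    have "eventually (\<lambda>n. d n < \<delta>) sequentially"
      using lim \<delta> by (rule order_tendstoD)
    then obtain N1 where N1: "\<And>n. n \<ge> N1 \<Longrightarrow> d n < \<delta>" by (auto simp: eventually_sequentially)
    obtain N2 where N2: "\<And>n. n \<ge> N2 \<Longrightarrow> norm (\<Sum>i. c (i + n) * d (i + n) powr s) < \<epsilon>"
      using suminf_exist_split[OF \<epsilon> summ] by blast
    define N where "N = max N1 N2"
    have "\<exists>h. bij_betw h {0..<card (C n)} (C n)" for n
      by (rule ex_bij_betw_nat_finite[OF fin])
    then obtain h where h: "\<And>n. bij_betw (h n) {0..<card (C n)} (C n)" by metis
    define U where "U = (\<lambda>(m,i). if i < card (C (m + N)) then h (m + N) i else {})"
    have hC: "h n i \<in> C n" if "i < card (C n)" for n i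
      using h[of n] that by (auto simp: bij_betw_def)
    have Ub: "bounded (U (m,i)) \<and> diameter (U (m,i)) \<le> \<delta>" for m i
      using bdd[OF hC[of i "m + N"]] N1[of "m + N", unfolded N_def] \<delta> by (fastforce simp: U_def N_def)
    have "E \<subseteq> (\<Union>k. U (prod_decode k))"
    proof
      fix x assume "x \<in> E"
      then obtain n where n: "n \<ge> N" "x \<in> \<Union>(C n)"
        using E[of x] unfolding infinite_nat_iff_unbounded_le by blast
      then obtain V where V: "V \<in> h n ` {0..<card (C n)}" "x \<in> V"
        using h[of n] by (auto simp: bij_betw_def)
      then obtain i where i: "i < card (C n)" "x \<in> h n i" by auto
      then have "x \<in> U (n - N, i)" using n by (simp add: U_def)
      then show "x \<in> (\<Union>k. U (prod_decode k))"
        by (metis UNIV_I UN_iff prod_encode_inverse)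
    qed
    then have "hausdorff_premeasure s \<delta> E \<le> (\<Sum>k. ennreal (hausdorff_gauge s (U (prod_decode k))))"
      by (rule hausdorff_premeasure_le) (metis Ub surj_pair)+
    also have "\<dots> = (\<Sum>m. \<Sum>i. ennreal (hausdorff_gauge s (U (m,i))))"
      by (rule suminf_ennreal_2dimen) simp
    also have "\<dots> \<le> (\<Sum>m. ennreal (c (m + N) * d (m + N) powr s))"
    proof (rule suminf_le)
      fix m
      have "(\<Sum>i. ennreal (hausdorff_gauge s (U (m,i))))
          = (\<Sum>i<card (C (m + N)). ennreal (hausdorff_gauge s (U (m,i))))"
        by (rule suminf_finite) (auto simp: U_def hausdorff_gauge_def)
      also have "\<dots> \<le> (\<Sum>i<card (C (m + N)). ennreal (d (m + N) powr s))"
      proof (intro sum_mono ennreal_leI)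
        fix i assume "i \<in> {..<card (C (m + N))}"
        then have U: "U (m,i) = h (m + N) i" "U (m,i) \<in> C (m + N)"
          using hC by (auto simp: U_def)
        show "hausdorff_gauge s (U (m,i)) \<le> d (m + N) powr s"
          using bdd[OF U(2)] s diameter_ge_0[of "U (m,i)"]
          by (auto simp: hausdorff_gauge_def intro: powr_mono2)
      qed
      also have "\<dots> = ennreal (real (card (C (m + N))) * d (m + N) powr s)"
        by (simp add: ennreal_mult ennreal_of_nat_eq_real_of_nat)
      also have "\<dots> \<le> ennreal (c (m + N) * d (m + N) powr s)"
        by (intro ennreal_leI mult_right_mono card) simp
      finally show "(\<Sum>i. ennreal (hausdorff_gauge s (U (m,i))))
          \<le> ennreal (c (m + N) * d (m + N) powr s)" .
    qed auto
    also have "\<dots> = ennreal (\<Sum>m. c (m + N) * d (m + N) powr s)"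
    proof (rule suminf_ennreal2)
      show "0 \<le> c (m + N) * d (m + N) powr s" for m
        using card[of "m + N"] by (simp add: order_trans[OF of_nat_0_le_iff])
      show "summable (\<lambda>m. c (m + N) * d (m + N) powr s)"
        using summ by (rule summable_ignore_initial_segment)
    qed
    also have "\<dots> \<le> ennreal \<epsilon>"
      using N2[of N] by (intro ennreal_leI) (auto simp: N_def)
    finally show ?thesis by simp
  qed
  then have "hausdorff_premeasure s \<delta> E \<le> 0" by (rule ennreal_le_epsilon)
  then show "hausdorff_premeasure s \<delta> E = 0" by simp
qed

text \<open>As \<open>0 \<le> \<beta> < 1\<close> and \<open>r \<le> 1\<close>, only the four integers from \<open>\<lfloor>y\<rfloor> - 2\<close> to \<open>\<lfloor>y\<rfloor> + 1\<close> can be within \<open>r\<close>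
  of \<open>y - \<beta>\<close>; each of them confines \<open>\<beta>\<close> to an interval of length \<open>2 r\<close>.\<close>

lemma card_grid_near_point_mod_1:
  fixes y \<rho> r :: real
  assumes \<rho>: "\<rho> > 0" and r: "0 \<le> r" "r \<le> 1"
  defines "S \<equiv> {\<lfloor>\<beta> / \<rho>\<rfloor> | \<beta>. 0 \<le> \<beta> \<and> \<beta> < 1 \<and> dist_nearest_int (y - \<beta>) \<le> r}"
  shows "finite S" "real (card S) \<le> 16 * max 1 (r / \<rho>)"
proof -
  define J where "J e = {\<lfloor>(y - of_int (\<lfloor>y\<rfloor> + e) - r) / \<rho>\<rfloor>..\<lfloor>(y - of_int (\<lfloor>y\<rfloor> + e) + r) / \<rho>\<rfloor>}" for e
  have sub: "S \<subseteq> (\<Union>e\<in>{-2..1}. J e)"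
  proof
    fix b assume "b \<in> S"
    then obtain \<beta> where b: "b = \<lfloor>\<beta> / \<rho>\<rfloor>" and \<beta>: "0 \<le> \<beta>" "\<beta> < 1" "dist_nearest_int (y - \<beta>) \<le> r"
      by (auto simp: S_def)
    from \<beta>(3) obtain k :: int where k: "\<bar>y - \<beta> - of_int k\<bar> \<le> r"
      by (auto simp: dist_nearest_int_le_iff)
    define e where "e = k - \<lfloor>y\<rfloor>"
    have "e \<in> {-2..1}" unfolding e_def using k \<beta> r by simp linarith
    moreover have "b \<in> J e" unfolding J_def b e_def
      using k \<rho> by (auto intro!: floor_mono divide_right_mono)
    ultimately show "b \<in> (\<Union>e\<in>{-2..1}. J e)" by blast
  qed
  have finJ: "finite (\<Union>e\<in>{-2..1}. J e)" by (auto simp: J_def)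
  show "finite S" using sub finJ by (rule finite_subset)
  have J: "real (card (J e)) \<le> 4 * max 1 (r / \<rho>)" for e
  proof -
    define a b where "a = (y - of_int (\<lfloor>y\<rfloor> + e) - r) / \<rho>" "b = (y - of_int (\<lfloor>y\<rfloor> + e) + r) / \<rho>"
    have ba: "b - a = 2 * (r / \<rho>)" using \<rho> by (simp add: a_b_def divide_simps)
    have "real (card (J e)) = real (nat (\<lfloor>b\<rfloor> - \<lfloor>a\<rfloor> + 1))"
      by (simp add: J_def a_b_def)
    also have "\<dots> \<le> b - a + 2"
    proof -
      have "0 \<le> r / \<rho>" using \<rho> r by simp
      then show ?thesis using ba by linarith
    qed
    also have "\<dots> \<le> 4 * max 1 (r / \<rho>)" unfolding ba by simp
    finally show ?thesis .
  qed
  have "card S \<le> card (\<Union>e\<in>{-2..1::int}. J e)" using finJ sub by (rule card_mono)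
  also have "\<dots> \<le> (\<Sum>e\<in>{-2..1::int}. card (J e))" by (rule card_UN_le) simp
  finally have "real (card S) \<le> (\<Sum>e\<in>{-2..1::int}. real (card (J e)))"
    by (metis of_nat_le_iff of_nat_sum)
  also have "\<dots> \<le> (\<Sum>e\<in>{-2..1::int}. 4 * max 1 (r / \<rho>))" by (intro sum_mono J)
  also have "\<dots> = 16 * max 1 (r / \<rho>)" by simp
  finally show "real (card S) \<le> 16 * max 1 (r / \<rho>)" .
qed

lemma diameter_grid_cell:
  fixes b :: "'n::finite \<Rightarrow> int"
  assumes "\<rho> > 0"
  shows "bounded {x::real^'n. \<forall>j. \<lfloor>x $ j / \<rho>\<rfloor> = b j}" (is "bounded ?C")
    and "diameter {x::real^'n. \<forall>j. \<lfloor>x $ j / \<rho>\<rfloor> = b j} \<le> real CARD('n) * \<rho>"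
proof -
  have d: "dist x y \<le> real CARD('n) * \<rho>" if "x \<in> ?C" "y \<in> ?C" for x y
  proof -
    have "\<bar>x $ j - y $ j\<bar> \<le> \<rho>" for j
    proof -
      have "\<lfloor>x $ j / \<rho>\<rfloor> = \<lfloor>y $ j / \<rho>\<rfloor>" using that by simp
      then have "\<bar>x $ j / \<rho> - y $ j / \<rho>\<bar> \<le> 1" by linarith
      then show ?thesis using assms by (simp add: diff_divide_distrib[symmetric] divide_le_eq)
    qed
    then have "(\<Sum>j\<in>UNIV. \<bar>(x - y) $ j\<bar>) \<le> (\<Sum>j\<in>(UNIV::'n set). \<rho>)" by (intro sum_mono) simp
    then show ?thesis unfolding dist_norm using norm_le_l1_cart[of "x - y"] by simp
  qed
  show "bounded ?C" unfolding bounded_two_points using d by blast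
  show "diameter ?C \<le> real CARD('n) * \<rho>"
    by (rule diameter_le) (use d assms in \<open>auto simp: dist_norm\<close>)
qed

text \<open>Cut the \<open>n\<close>-th target into grid cells of side \<open>n powr (- \<tau> i)\<close>. In direction \<open>j\<close> this takes about
  \<open>n powr (\<tau> i - \<tau> j)\<close> cells if \<open>\<tau> j < \<tau> i\<close>, and boundedly many otherwise.\<close>

lemma shrinking_target_set_null:
  fixes A :: "nat \<Rightarrow> int ^ 'n ^ 'n" and \<tau> :: "'n::finite \<Rightarrow> real"
  assumes \<tau>: "\<And>i. 0 < \<tau> i"
    and r: "\<And>i n. 1 \<le> n \<Longrightarrow> r i n = real n powr (- \<tau> i)"
    and s: "s > (1 + (\<Sum>j | \<tau> j < \<tau> i. \<tau> i - \<tau> j)) / \<tau> i"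
  shows "hausdorff_measure s (shrinking_target_set \<alpha> A r) = 0"
proof -
  define \<sigma> where "\<sigma> = (\<Sum>j | \<tau> j < \<tau> i. \<tau> i - \<tau> j)"
  define D where "D = real CARD('n)"
  define y where "y n = int_mat_apply (A n) \<alpha>" for n
  define \<rho> where "\<rho> n = real n powr (- \<tau> i)" for n
  define S where "S n j = {\<lfloor>\<beta> / \<rho> n\<rfloor> | \<beta>. 0 \<le> \<beta> \<and> \<beta> < 1 \<and> dist_nearest_int (y n $ j - \<beta>) \<le> r j n}"
    for n j
  define C where "C n = (if n = 0 then {} else (\<lambda>b. {x::real^'n. \<forall>j. \<lfloor>x $ j / \<rho> n\<rfloor> = b j}) ` (PiE UNIV (S n)))"
    for n
  have S: "finite (S n j)" "real (card (S n j)) \<le> 16 * max 1 (r j n / \<rho> n)" if "n \<ge> 1" for n j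
    unfolding S_def
    by (rule card_grid_near_point_mod_1;
        use that r \<tau> in \<open>auto simp: \<rho>_def powr_minus inverse_le_1_iff ge_one_powr_ge_zero less_imp_le\<close>)+
  have \<sigma>: "0 \<le> \<sigma>" unfolding \<sigma>_def by (intro sum_nonneg) auto
  have s0: "s > 0" using s \<sigma> \<tau>[of i] unfolding \<sigma>_def[symmetric]
    by (meson add_nonneg_nonneg divide_nonneg_pos le_less_trans zero_le_one)
  show ?thesis
  proof (rule hausdorff_measure_limsup_null[OF s0, of C "\<lambda>n. D * \<rho> n" "\<lambda>n. 16 ^ CARD('n) * real n powr \<sigma>"])
    show "finite (C n)" for n
      using S(1)[of n] by (auto simp: C_def intro!: finite_imageI finite_PiE)
    show "bounded U \<and> diameter U \<le> D * \<rho> n" if "U \<in> C n" for n U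
    proof -
      from that have "n \<noteq> 0" by (auto simp: C_def split: if_splits)
      then have \<rho>: "\<rho> n > 0" by (simp add: \<rho>_def)
      from that obtain b where "U = {x::real^'n. \<forall>j. \<lfloor>x $ j / \<rho> n\<rfloor> = b j}" by (auto simp: C_def split: if_splits)
      with diameter_grid_cell[OF \<rho>, of b] show ?thesis by (simp add: D_def)
    qed
    show "real (card (C n)) \<le> 16 ^ CARD('n) * real n powr \<sigma>" for n
    proof (cases "n = 0")
      case False
      then have n: "n \<ge> 1" by simp
      have "card (C n) \<le> card (PiE UNIV (S n))"
        using False S(1)[OF n] by (auto simp: C_def intro!: card_image_le finite_PiE)
      then have "real (card (C n)) \<le> (\<Prod>j\<in>UNIV. real (card (S n j)))"
        by (simp add: card_PiE flip: of_nat_prod)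
      also have "\<dots> \<le> (\<Prod>j\<in>(UNIV::'n set). 16 * max 1 (r j n / \<rho> n))"
        using S(2)[OF n] by (intro prod_mono) auto
      also have "\<dots> = 16 ^ CARD('n) * (\<Prod>j\<in>UNIV. max 1 (r j n / \<rho> n))"
        by (simp add: prod.distrib)
      also have "(\<Prod>j\<in>UNIV. max 1 (r j n / \<rho> n)) = (\<Prod>j\<in>UNIV. real n powr (if \<tau> j < \<tau> i then \<tau> i - \<tau> j else 0))"
      proof (rule prod.cong[OF refl])
        fix j
        have "r j n / \<rho> n = real n powr (\<tau> i - \<tau> j)"
          using n by (simp add: r \<rho>_def powr_diff powr_minus field_simps)
        moreover have "\<tau> j < \<tau> i \<Longrightarrow> 1 \<le> real n powr (\<tau> i - \<tau> j)"
          using n by (intro ge_one_powr_ge_zero) auto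
        moreover have "\<not> \<tau> j < \<tau> i \<Longrightarrow> real n powr (\<tau> i - \<tau> j) \<le> real n powr 0"
          using n by (intro powr_mono) auto
        ultimately show "max 1 (r j n / \<rho> n) = real n powr (if \<tau> j < \<tau> i then \<tau> i - \<tau> j else 0)"
          using n by (auto simp: max_def)
      qed
      also have "\<dots> = real n powr (\<Sum>j\<in>UNIV. if \<tau> j < \<tau> i then \<tau> i - \<tau> j else 0)"
        using n by (simp add: powr_sum)
      also have "(\<Sum>j\<in>UNIV. if \<tau> j < \<tau> i then \<tau> i - \<tau> j else 0) = \<sigma>"
        by (simp add: \<sigma>_def sum.If_cases)
      finally show ?thesis .
    qed (simp add: C_def)
    show "(\<lambda>n. D * \<rho> n) \<longlonglongrightarrow> 0"
      unfolding \<rho>_def using \<tau>[of i]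
      by (intro tendsto_mult_right_zero tendsto_neg_powr filterlim_real_sequentially) auto
    have "\<sigma> - \<tau> i * s < -1"
      using s \<tau>[of i] by (simp add: \<sigma>_def[symmetric] divide_less_eq mult.commute)
    then have "summable (\<lambda>n. real n powr (\<sigma> - \<tau> i * s))" by (simp add: summable_real_powr_iff)
    then have "summable (\<lambda>n. (16 ^ CARD('n) * D powr s) * real n powr (\<sigma> - \<tau> i * s))"
      by (rule summable_mult)
    moreover have "16 ^ CARD('n) * real n powr \<sigma> * (D * \<rho> n) powr s
        = (16 ^ CARD('n) * D powr s) * real n powr (\<sigma> - \<tau> i * s)" for n
    proof -
      have "real n powr (\<sigma> - \<tau> i * s) = real n powr \<sigma> * real n powr (- \<tau> i * s)"
        by (simp flip: powr_add)
      moreover have "(D * \<rho> n) powr s = D powr s * real n powr (- \<tau> i * s)"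
        by (simp add: \<rho>_def D_def powr_mult powr_powr)
      ultimately show ?thesis by simp
    qed
    ultimately show "summable (\<lambda>n. 16 ^ CARD('n) * real n powr \<sigma> * (D * \<rho> n) powr s)"
      by presburger
    show "infinite {n. x \<in> \<Union>(C n)}" if "x \<in> shrinking_target_set \<alpha> A r" for x
    proof -
      have x: "x \<in> unit_cube" and
        inf: "infinite {n. 1 \<le> n \<and> (\<forall>i. dist_nearest_int (y n $ i - x $ i) \<le> r i n)}"
        using that unfolding mem_shrinking_target_set_iff y_def by auto
      have "x \<in> \<Union>(C n)" if n: "1 \<le> n" "\<forall>i. dist_nearest_int (y n $ i - x $ i) \<le> r i n" for n
      proof -
        have "\<lfloor>x $ j / \<rho> n\<rfloor> \<in> S n j" for j
          using x n unfolding S_def unit_cube_def by blast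
        then have "(\<lambda>j. \<lfloor>x $ j / \<rho> n\<rfloor>) \<in> PiE UNIV (S n)" by auto
        then show ?thesis using n(1) by (auto simp: C_def)
      qed
      then have "{n. 1 \<le> n \<and> (\<forall>i. dist_nearest_int (y n $ i - x $ i) \<le> r i n)} \<subseteq> {n. x \<in> \<Union>(C n)}" by blast
      with inf show ?thesis using finite_subset by blast
    qed
  qed
qed

section \<open>Averages of periodic functions\<close>

lemma unit_cube_borel [measurable]: "unit_cube \<in> sets borel"
  unfolding unit_cube_def by measurable

definition cube_measure :: "(real ^ 'n) measure" where
  "cube_measure = restrict_space lborel unit_cube"

lemma space_cube_measure [simp]: "space cube_measure = unit_cube"
  by (simp add: cube_measure_def space_restrict_space)

lemma sets_cube_measure: "S \<in> sets borel \<Longrightarrow> S \<subseteq> unit_cube \<Longrightarrow> S \<in> sets cube_measure"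
  unfolding cube_measure_def by (simp add: sets_restrict_space_iff)

lemma measurable_cube_measure:
  "f \<in> borel_measurable borel \<Longrightarrow> f \<in> borel_measurable cube_measure"
  unfolding cube_measure_def by (rule measurable_restrict_space1) simp

lemma measurable_cube_measure_id [measurable]: "(\<lambda>x. x) \<in> measurable cube_measure borel"
  by (rule measurable_cube_measure) simp

lemma nn_integral_cube_measure:
  "(\<integral>\<^sup>+x. f x \<partial>cube_measure) = (\<integral>\<^sup>+x. f x * indicator unit_cube x \<partial>lborel)"
  unfolding cube_measure_def by (rule nn_integral_restrict_space) simp

definition int_vector :: "real ^ 'n \<Rightarrow> bool" where
  "int_vector z \<longleftrightarrow> (\<forall>i. z $ i \<in> \<int>)"

definition unit_periodic :: "(real ^ 'n \<Rightarrow> 'b) \<Rightarrow> bool" where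
  "unit_periodic H \<longleftrightarrow> (\<forall>x z. int_vector z \<longrightarrow> H (x + z) = H x)"

lemma nn_integral_lborel_shift:
  fixes f :: "'a::euclidean_space \<Rightarrow> ennreal"
  assumes [measurable]: "f \<in> borel_measurable borel"
  shows "(\<integral>\<^sup>+x. f (x + t) \<partial>lborel) = (\<integral>\<^sup>+x. f x \<partial>lborel)"
proof -
  have "(\<integral>\<^sup>+x. f x \<partial>lborel) = (\<integral>\<^sup>+x. f x \<partial>distr lborel borel ((+) t))"
    by (simp add: lborel_distr_plus)
  also have "\<dots> = (\<integral>\<^sup>+x. f (t + x) \<partial>lborel)"
    by (subst nn_integral_distr) auto
  finally show ?thesis by (simp add: add.commute)
qed

lemma minus_mem_unit_cube_iff:
  assumes "int_vector z"
  shows "x - z \<in> unit_cube \<longleftrightarrow> z = (\<chi> i. of_int \<lfloor>x $ i\<rfloor>)"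
proof -
  have "(0 \<le> x $ i - z $ i \<and> x $ i - z $ i < 1) \<longleftrightarrow> z $ i = of_int \<lfloor>x $ i\<rfloor>" for i
  proof -
    obtain k where "z $ i = of_int k" using assms by (auto simp: int_vector_def Ints_def)
    then show ?thesis by (simp add: floor_eq_iff) linarith
  qed
  then show ?thesis by (simp add: unit_cube_def vec_eq_iff)
qed

text \<open>The torus acts on itself by measure-preserving translations: both \<open>unit_cube\<close> and its
  translate by \<open>t\<close> are fundamental domains of the integer lattice, and only the finitely many
  lattice translates in \<open>Z\<close> of the one meet the other.\<close>

lemma nn_integral_cube_shift:
  fixes H :: "real ^ 'n \<Rightarrow> ennreal"
  assumes [measurable]: "H \<in> borel_measurable borel" and per: "unit_periodic H"
  shows "(\<integral>\<^sup>+x. H (x + t) \<partial>cube_measure) = (\<integral>\<^sup>+x. H x \<partial>cube_measure)"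
proof -
  define I where "I x = (indicator unit_cube x :: ennreal)" for x :: "real ^ 'n"
  have [measurable]: "I \<in> borel_measurable borel" unfolding I_def by measurable
  define Z where "Z = {z :: real ^ 'n. \<forall>i. z $ i \<in> {of_int \<lfloor>t $ i\<rfloor>, of_int \<lfloor>t $ i\<rfloor> + 1}}"
  have Zint: "int_vector z" if "z \<in> Z" for z
    unfolding int_vector_def
  proof
    fix i
    have "z $ i \<in> {of_int \<lfloor>t $ i\<rfloor>, of_int \<lfloor>t $ i\<rfloor> + 1}" using that unfolding Z_def by blast
    then show "z $ i \<in> \<int>" by auto
  qed
  have finZ: "finite Z"
  proof (rule finite_subset)
    show "Z \<subseteq> (\<lambda>f. \<chi> i. f i) ` (PiE UNIV (\<lambda>i. {of_int \<lfloor>t $ i\<rfloor>, of_int \<lfloor>t $ i\<rfloor> + 1}))"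
    proof
      fix z assume "z \<in> Z"
      then have "(\<lambda>i. z $ i) \<in> PiE UNIV (\<lambda>i. {of_int \<lfloor>t $ i\<rfloor>, of_int \<lfloor>t $ i\<rfloor> + 1})"
        unfolding Z_def PiE_UNIV_domain by blast
      then show "z \<in> (\<lambda>f. \<chi> i. f i) ` (PiE UNIV (\<lambda>i. {of_int \<lfloor>t $ i\<rfloor>, of_int \<lfloor>t $ i\<rfloor> + 1}))"
        by (intro image_eqI[of _ _ "\<lambda>i. z $ i"]) (simp_all add: vec_eq_iff)
    qed
  qed (intro finite_imageI finite_PiE; simp)
  have one: "(\<Sum>z\<in>Z. I (x - z)) = 1" if "x - t \<in> unit_cube" for x
  proof -
    have "real_of_int \<lfloor>x $ i\<rfloor> \<in> {of_int \<lfloor>t $ i\<rfloor>, of_int \<lfloor>t $ i\<rfloor> + 1}" for i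
    proof -
      have "0 \<le> x $ i - t $ i" "x $ i - t $ i < 1" using that by (auto simp: unit_cube_def)
      then have "\<lfloor>x $ i\<rfloor> = \<lfloor>t $ i\<rfloor> \<or> \<lfloor>x $ i\<rfloor> = \<lfloor>t $ i\<rfloor> + 1" by linarith
      then show ?thesis by auto
    qed
    then have "(\<chi> i. of_int \<lfloor>x $ i\<rfloor>) \<in> Z" by (simp add: Z_def)
    moreover have "I (x - z) = (if z = (\<chi> i. of_int \<lfloor>x $ i\<rfloor>) then 1 else 0)" if "z \<in> Z" for z
      using minus_mem_unit_cube_iff[OF Zint[OF that]] by (simp add: I_def indicator_def)
    ultimately show ?thesis using finZ by simp
  qed
  have two: "(\<Sum>z\<in>Z. I (x + z - t)) = 1" if "x \<in> unit_cube" for x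
  proof -
    define w where "w = (\<chi> i. - real_of_int \<lfloor>x $ i - t $ i\<rfloor>)"
    have "- real_of_int \<lfloor>x $ i - t $ i\<rfloor> \<in> {of_int \<lfloor>t $ i\<rfloor>, of_int \<lfloor>t $ i\<rfloor> + 1}" for i
    proof -
      have "0 \<le> x $ i" "x $ i < 1" using that by (auto simp: unit_cube_def)
      then have "\<lfloor>x $ i - t $ i\<rfloor> = - \<lfloor>t $ i\<rfloor> \<or> \<lfloor>x $ i - t $ i\<rfloor> = - \<lfloor>t $ i\<rfloor> - 1" by linarith
      then show ?thesis by auto
    qed
    then have "w \<in> Z" by (simp add: Z_def w_def)
    moreover have "I (x + z - t) = (if z = w then 1 else 0)" if "z \<in> Z" for z
    proof -
      have "int_vector (- z)" using Zint[OF that] by (simp add: int_vector_def)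
      from minus_mem_unit_cube_iff[OF this, of "x - t"]
      have "x + z - t \<in> unit_cube \<longleftrightarrow> - z = - w" 
        by (simp add: w_def vec_eq_iff algebra_simps)
      then show ?thesis by (simp add: I_def indicator_def)
    qed
    ultimately show ?thesis using finZ by simp
  qed
  have "(\<integral>\<^sup>+x. H (x + t) \<partial>cube_measure) = (\<integral>\<^sup>+x. H (x + t) * I (x + t - t) \<partial>lborel)"
    by (simp add: nn_integral_cube_measure I_def)
  also have "\<dots> = (\<integral>\<^sup>+x. H x * I (x - t) \<partial>lborel)"
    by (rule nn_integral_lborel_shift[of "\<lambda>x. H x * I (x - t)"]) measurable
  also have "\<dots> = (\<integral>\<^sup>+x. (\<Sum>z\<in>Z. H x * I (x - t) * I (x - z)) \<partial>lborel)"
    by (rule nn_integral_cong) (auto simp: I_def[of "_ - t"] one indicator_def simp flip: sum_distrib_left)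
  also have "\<dots> = (\<Sum>z\<in>Z. \<integral>\<^sup>+x. H x * I (x - t) * I (x - z) \<partial>lborel)"
    by (rule nn_integral_sum) (unfold measurable_lborel1 measurable_lborel2, measurable)
  also have "\<dots> = (\<Sum>z\<in>Z. \<integral>\<^sup>+x. H x * I (x + z - t) * I x \<partial>lborel)"
  proof (rule sum.cong[OF refl])
    fix z assume "z \<in> Z"
    then have "H (x + z) = H x" for x using per Zint by (simp add: unit_periodic_def)
    then have "(\<integral>\<^sup>+x. H x * I (x + z - t) * I x \<partial>lborel)
        = (\<integral>\<^sup>+x. H (x + z) * I (x + z - t) * I (x + z - z) \<partial>lborel)" by simp
    also have "\<dots> = (\<integral>\<^sup>+x. H x * I (x - t) * I (x - z) \<partial>lborel)"
      by (rule nn_integral_lborel_shift[of "\<lambda>x. H x * I (x - t) * I (x - z)"]) measurable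
    finally show "(\<integral>\<^sup>+x. H x * I (x - t) * I (x - z) \<partial>lborel)
        = (\<integral>\<^sup>+x. H x * I (x + z - t) * I x \<partial>lborel)" by simp
  qed
  also have "\<dots> = (\<integral>\<^sup>+x. (\<Sum>z\<in>Z. H x * I (x + z - t) * I x) \<partial>lborel)"
    by (rule nn_integral_sum[symmetric]) (unfold measurable_lborel1 measurable_lborel2, measurable)
  also have "\<dots> = (\<integral>\<^sup>+x. H x * I x \<partial>lborel)"
    by (rule nn_integral_cong)
       (auto simp: I_def[of "_ :: real ^ 'n"] indicator_def sum_distrib_right[symmetric] sum_distrib_left[symmetric]
          two[unfolded I_def indicator_def])
  also have "\<dots> = (\<integral>\<^sup>+x. H x \<partial>cube_measure)"
    by (simp add: nn_integral_cube_measure I_def)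
  finally show ?thesis .
qed

lemma emeasure_half_open_box:
  fixes l u :: "real ^ 'n"
  assumes lu: "\<And>i. l $ i \<le> u $ i"
  shows "emeasure lborel {x. \<forall>i. l $ i \<le> x $ i \<and> x $ i < u $ i} = ennreal (\<Prod>i\<in>UNIV. u $ i - l $ i)"
    (is "emeasure lborel ?S = _")
proof -
  have ne: "cbox l u \<noteq> {}" using lu by (simp add: interval_ne_empty_cart)
  have cbox: "emeasure lborel (cbox l u) = ennreal (\<Prod>i\<in>UNIV. u $ i - l $ i)"
    using content_cbox_cart[OF ne] by (metis emeasure_eq_ennreal_measure emeasure_lborel_cbox_finite less_irrefl infinity_ennreal_def)
  have box: "emeasure lborel (box l u) = emeasure lborel (cbox l u)"
    by (simp add: emeasure_lborel_box_eq emeasure_lborel_cbox_eq)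
  have [measurable]: "?S \<in> sets borel" by measurable
  have "box l u \<subseteq> ?S" "?S \<subseteq> cbox l u"
    by (auto simp: mem_box_cart less_imp_le)
  then show ?thesis
    using emeasure_mono[of "box l u" ?S lborel] emeasure_mono[of ?S "cbox l u" lborel] box cbox
    by (simp add: antisym)
qed

lemma emeasure_unit_cube: "emeasure lborel (unit_cube :: (real ^ 'n) set) = 1"
  using emeasure_half_open_box[of "0 :: real ^ 'n" 1] by (simp add: unit_cube_def)

lemma emeasure_cube_measure_space: "emeasure cube_measure (unit_cube :: (real ^ 'n) set) = 1"
  by (simp add: cube_measure_def emeasure_restrict_space emeasure_unit_cube)

lemma finite_measure_cube_measure: "finite_measure cube_measure"
  by (rule finite_measureI) (simp add: emeasure_cube_measure_space)

lemma int_mat_apply_add: "int_mat_apply M (x + y) = int_mat_apply M x + int_mat_apply M y"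
  by (simp add: int_mat_apply_def matrix_vector_right_distrib)

lemma int_mat_apply_diff: "int_mat_apply (M - N) x = int_mat_apply M x - int_mat_apply N x"
  by (simp add: int_mat_apply_def vec_eq_iff matrix_vector_mult_def sum_subtractf left_diff_distrib)

lemma int_mat_apply_measurable [measurable]: "int_mat_apply M \<in> borel_measurable borel"
  unfolding int_mat_apply_def
  by (intro borel_measurable_continuous_onI matrix_vector_mult_linear_continuous_on)

lemma int_vector_int_mat_apply: "int_vector z \<Longrightarrow> int_vector (int_mat_apply M z)"
  by (auto simp: int_vector_def int_mat_apply_def matrix_vector_mult_def intro!: Ints_sum Ints_mult)

lemma surj_int_mat_apply:
  assumes "det M \<noteq> 0"
  shows "surj (int_mat_apply (M :: int ^ 'n ^ 'n))"
proof -
  have "det (\<chi> i j. real_of_int (M $ i $ j)) = of_int (det M)"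
    by (simp add: det_def)
  then have "invertible (\<chi> i j. real_of_int (M $ i $ j))"
    using assms by (simp add: invertible_det_nz)
  then have "surj ((*v) (\<chi> i j. real_of_int (M $ i $ j)))"
    by (metis invertible_right_inverse matrix_right_invertible_surjective)
  then show ?thesis by (simp add: int_mat_apply_def[abs_def])
qed

text \<open>The average of \<open>G (x + M a)\<close> over \<open>a\<close> does not depend on \<open>x\<close>, because \<open>x\<close> is itself a value of \<open>M\<close>
  and can be absorbed into a translation of \<open>a\<close>. Averaging over \<open>x\<close> as well gives the average of
  \<open>G\<close>. This is the uniqueness of Haar measure, specialised to the image of Haar measure under the
  endomorphism of the torus given by \<open>M\<close>.\<close>

lemma nn_integral_cube_int_mat_apply:
  fixes G :: "real ^ 'n \<Rightarrow> ennreal" and M :: "int ^ 'n ^ 'n"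
  assumes [measurable]: "G \<in> borel_measurable borel" and per: "unit_periodic G" and det: "det M \<noteq> 0"
  shows "(\<integral>\<^sup>+a. G (x + int_mat_apply M a) \<partial>cube_measure) = (\<integral>\<^sup>+y. G y \<partial>cube_measure)"
proof -
  interpret C: finite_measure "cube_measure :: (real ^ 'n) measure" by (rule finite_measure_cube_measure)
  interpret P: pair_sigma_finite "cube_measure :: (real ^ 'n) measure" "cube_measure :: (real ^ 'n) measure" ..
  have shift: "(\<integral>\<^sup>+a. G (y + (x + int_mat_apply M a)) \<partial>cube_measure)
      = (\<integral>\<^sup>+a. G (x + int_mat_apply M a) \<partial>cube_measure)" for y
  proof -
    obtain b where b: "y = int_mat_apply M b" using surj_int_mat_apply[OF det] by blast
    have "unit_periodic (\<lambda>a. G (x + int_mat_apply M a))"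
      using per by (simp add: unit_periodic_def int_mat_apply_add int_vector_int_mat_apply
          flip: add.assoc)
    then have "(\<integral>\<^sup>+a. G (x + int_mat_apply M (a + b)) \<partial>cube_measure)
      = (\<integral>\<^sup>+a. G (x + int_mat_apply M a) \<partial>cube_measure)"
      by (intro nn_integral_cube_shift[of "\<lambda>a. G (x + int_mat_apply M a)"]) measurable
    then show ?thesis by (simp add: b int_mat_apply_add algebra_simps)
  qed
  have "(\<integral>\<^sup>+a. G (x + int_mat_apply M a) \<partial>cube_measure)
      = (\<integral>\<^sup>+y. \<integral>\<^sup>+a. G (y + (x + int_mat_apply M a)) \<partial>cube_measure \<partial>(cube_measure :: (real ^ 'n) measure))"
    by (simp add: shift emeasure_cube_measure_space)
  also have "\<dots> = (\<integral>\<^sup>+a. \<integral>\<^sup>+y. G (y + (x + int_mat_apply M a)) \<partial>cube_measure \<partial>cube_measure)"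
    by (rule P.Fubini') measurable
  also have "\<dots> = (\<integral>\<^sup>+a. \<integral>\<^sup>+y. G y \<partial>cube_measure \<partial>(cube_measure :: (real ^ 'n) measure))"
    by (simp add: nn_integral_cube_shift[OF _ per])
  finally show ?thesis by (simp add: emeasure_cube_measure_space)
qed

text \<open>Translating \<open>x\<close> by \<open>M a\<close> leaves a product of \<open>H x\<close> and \<open>G (x + (N - M) a)\<close>, and for each \<open>x\<close> the
  second factor averages over \<open>a\<close> to a constant. In the language of probability: for independent
  uniform \<open>x\<close> and \<open>a\<close>, the points \<open>x + M a\<close> and \<open>x + N a\<close> of the torus are independent.\<close>

lemma nn_integral_cube_independent:
  fixes H G :: "real ^ 'n \<Rightarrow> ennreal" and M N :: "int ^ 'n ^ 'n"
  assumes [measurable]: "H \<in> borel_measurable borel" "G \<in> borel_measurable borel"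
    and per: "unit_periodic H" "unit_periodic G" and det: "det (N - M) \<noteq> 0"
  shows "(\<integral>\<^sup>+a. \<integral>\<^sup>+x. H (x + int_mat_apply M a) * G (x + int_mat_apply N a) \<partial>cube_measure \<partial>cube_measure)
    = (\<integral>\<^sup>+x. H x \<partial>cube_measure) * (\<integral>\<^sup>+x. G x \<partial>cube_measure)"
proof -
  interpret C: finite_measure "cube_measure :: (real ^ 'n) measure" by (rule finite_measure_cube_measure)
  interpret P: pair_sigma_finite "cube_measure :: (real ^ 'n) measure" "cube_measure :: (real ^ 'n) measure" ..
  have "(\<integral>\<^sup>+x. H (x + int_mat_apply M a) * G (x + int_mat_apply N a) \<partial>cube_measure)
      = (\<integral>\<^sup>+x. H x * G (x + int_mat_apply (N - M) a) \<partial>cube_measure)" for a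
  proof -
    have "unit_periodic (\<lambda>x. H x * G (x + int_mat_apply (N - M) a))"
      unfolding unit_periodic_def
    proof (intro allI impI)
      fix x z :: "real ^ 'n" assume z: "int_vector z"
      have "x + z + int_mat_apply (N - M) a = (x + int_mat_apply (N - M) a) + z" by simp
      then show "H (x + z) * G (x + z + int_mat_apply (N - M) a) = H x * G (x + int_mat_apply (N - M) a)"
        using per z unfolding unit_periodic_def by metis
    qed
    from nn_integral_cube_shift[OF _ this, of "int_mat_apply M a"]
    show ?thesis by (simp add: int_mat_apply_diff add.assoc)
  qed
  then have "(\<integral>\<^sup>+a. \<integral>\<^sup>+x. H (x + int_mat_apply M a) * G (x + int_mat_apply N a) \<partial>cube_measure \<partial>cube_measure)
      = (\<integral>\<^sup>+a. \<integral>\<^sup>+x. H x * G (x + int_mat_apply (N - M) a) \<partial>cube_measure \<partial>cube_measure)" by simp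
  also have "\<dots> = (\<integral>\<^sup>+x. \<integral>\<^sup>+a. H x * G (x + int_mat_apply (N - M) a) \<partial>cube_measure \<partial>cube_measure)"
    by (rule P.Fubini') measurable
  also have "\<dots> = (\<integral>\<^sup>+x. H x * (\<integral>\<^sup>+y. G y \<partial>cube_measure) \<partial>cube_measure)"
    by (simp add: nn_integral_cmult nn_integral_cube_int_mat_apply[OF _ per(2) det])
  finally show ?thesis by (simp add: nn_integral_multc)
qed

section \<open>Dyadic boxes\<close>

definition dyadic_index :: "('n \<Rightarrow> nat) \<Rightarrow> real ^ 'n \<Rightarrow> 'n \<Rightarrow> int" where
  "dyadic_index p x = (\<lambda>i. \<lfloor>2 ^ p i * x $ i\<rfloor>)"

definition dyadic_box :: "('n \<Rightarrow> nat) \<Rightarrow> ('n \<Rightarrow> int) \<Rightarrow> (real ^ 'n) set" where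
  "dyadic_box p a = {x. dyadic_index p x = a}"

definition dyadic_indices :: "('n \<Rightarrow> nat) \<Rightarrow> ('n \<Rightarrow> int) set" where
  "dyadic_indices p = PiE UNIV (\<lambda>i. {0..<2 ^ p i})"

abbreviation dyadic_cube :: "nat \<Rightarrow> ('n \<Rightarrow> int) \<Rightarrow> (real ^ 'n) set" where
  "dyadic_cube m \<equiv> dyadic_box (\<lambda>_. m)"

lemma mem_dyadic_box_iff: "x \<in> dyadic_box p a \<longleftrightarrow> dyadic_index p x = a"
  by (simp add: dyadic_box_def)

lemma dyadic_box_conv_half_open:
  "dyadic_box p a = {x. \<forall>i. (\<chi> i. of_int (a i) / 2 ^ p i) $ i \<le> x $ i \<and> x $ i < (\<chi> i. (of_int (a i) + 1) / 2 ^ p i) $ i}"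
  by (auto simp: dyadic_box_def dyadic_index_def fun_eq_iff floor_eq_iff field_simps)

lemma dyadic_box_borel [measurable]: "dyadic_box p a \<in> sets borel"
  unfolding dyadic_box_conv_half_open by measurable

lemma emeasure_dyadic_box: "emeasure lborel (dyadic_box p a) = ennreal (\<Prod>i\<in>UNIV. 1 / 2 ^ p i)"
proof -
  have "emeasure lborel (dyadic_box p a) = ennreal (\<Prod>i\<in>UNIV. (\<chi> i. (real_of_int (a i) + 1) / 2 ^ p i) $ i - (\<chi> i. of_int (a i) / 2 ^ p i) $ i)"
    unfolding dyadic_box_conv_half_open by (rule emeasure_half_open_box) (simp add: field_simps)
  then show ?thesis by (simp flip: diff_divide_distrib)
qed

lemma measure_dyadic_box: "measure lborel (dyadic_box p a) = (\<Prod>i\<in>UNIV. 1 / 2 ^ p i)"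
  by (simp add: measure_def emeasure_dyadic_box prod_nonneg)

lemma finite_dyadic_indices [simp]: "finite (dyadic_indices (p :: 'n::finite \<Rightarrow> nat))"
  unfolding dyadic_indices_def by (intro finite_PiE) auto

lemma card_dyadic_indices: "card (dyadic_indices (p :: 'n::finite \<Rightarrow> nat)) = (\<Prod>i\<in>UNIV. 2 ^ p i)"
  unfolding dyadic_indices_def by (simp add: card_PiE nat_power_eq)

lemma dyadic_index_mem_iff: "dyadic_index p x \<in> dyadic_indices p \<longleftrightarrow> x \<in> unit_cube"
proof -
  have "0 \<le> \<lfloor>2 ^ p i * x $ i\<rfloor> \<and> \<lfloor>2 ^ p i * x $ i\<rfloor> < 2 ^ p i \<longleftrightarrow> 0 \<le> x $ i \<and> x $ i < 1" for i
  proof -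
    have "\<lfloor>2 ^ p i * x $ i\<rfloor> < 2 ^ p i \<longleftrightarrow> 2 ^ p i * x $ i < 2 ^ p i" by (simp add: floor_less_iff)
    moreover have "0 \<le> \<lfloor>2 ^ p i * x $ i\<rfloor> \<longleftrightarrow> 0 \<le> x $ i"
      using mult_le_cancel_left_pos[of "2 ^ p i" 0 "x $ i"] by simp
    ultimately show ?thesis by simp
  qed
  then show ?thesis by (simp add: dyadic_indices_def PiE_UNIV_domain Pi_iff dyadic_index_def unit_cube_def)
qed

lemma dyadic_box_subset_unit_cube: "a \<in> dyadic_indices p \<Longrightarrow> dyadic_box p a \<subseteq> unit_cube"
  using dyadic_index_mem_iff by (fastforce simp: mem_dyadic_box_iff)

lemma dyadic_index_coarsen:
  assumes "\<And>i. p i \<le> q i" "dyadic_index q x = dyadic_index q y"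
  shows "dyadic_index p x = dyadic_index p y"
proof
  fix i
  have *: "\<lfloor>2 ^ p i * u\<rfloor> = \<lfloor>2 ^ q i * u\<rfloor> div 2 ^ (q i - p i)" for u :: real
  proof -
    have "2 ^ p i * u = 2 ^ q i * u / real_of_int (2 ^ (q i - p i))"
    proof -
      have "2 ^ q i = (2 ^ p i * 2 ^ (q i - p i) :: real)"
        using assms(1)[of i] by (simp flip: power_add)
      then show ?thesis by simp
    qed
    also have "\<lfloor>\<dots>\<rfloor> = \<lfloor>2 ^ q i * u\<rfloor> div 2 ^ (q i - p i)"
      by (rule floor_divide_real_eq_div) simp
    finally show ?thesis .
  qed
  have "\<lfloor>2 ^ q i * x $ i\<rfloor> = \<lfloor>2 ^ q i * y $ i\<rfloor>"
    using assms(2) by (simp add: dyadic_index_def fun_eq_iff)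
  then show "dyadic_index p x i = dyadic_index p y i" by (simp add: dyadic_index_def *)
qed

section \<open>Dyadic energy and Hausdorff measure\<close>

definition dyadic_mass :: "(real ^ 'n \<Rightarrow> real) \<Rightarrow> nat \<Rightarrow> ('n \<Rightarrow> int) \<Rightarrow> real" where
  "dyadic_mass f m a = (\<integral>x. indicator (dyadic_cube m a) x * f x \<partial>lborel)"

text \<open>As \<open>L\<close> tends to infinity, the square of this norm becomes comparable to the energy
  \<open>\<integral>\<integral>\<bar>x - y\<bar>\<^sup>-\<^sup>s f x f y\<close> with the distance replaced by the dyadic ultrametric. The truncation at
  \<open>L\<close> makes it a Euclidean norm on finitely many masses, for which the triangle inequality is
  available and finiteness is no issue; bounds have to be uniform in \<open>L\<close>.\<close>

definition dyadic_norm :: "real \<Rightarrow> nat \<Rightarrow> (real ^ 'n \<Rightarrow> real) \<Rightarrow> real" where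
  "dyadic_norm s L f =
     L2_set (\<lambda>(m,a). 2 powr (s * m / 2) * dyadic_mass f m a) (SIGMA m:{..<L}. dyadic_indices (\<lambda>_. m))"

text \<open>The summand \<open>\<eta>\<close> is there for sets of diameter \<open>0\<close>, which contribute nothing to a Hausdorff sum but
  have to be enclosed in cubes of positive size.\<close>

lemma dyadic_scale_exists:
  fixes D s \<eta> :: real
  assumes "0 \<le> D" "D < 1" "0 < s" "0 < \<eta>"
  shows "\<exists>m::nat. D < (1/2) ^ m \<and> ((1/2) ^ m) powr s \<le> 2 powr s * D powr s + \<eta>"
proof (cases "D = 0")
  case True
  obtain m :: nat where m: "(1/2) ^ m < \<eta> powr (1/s)"
    using real_arch_pow_inv[of "\<eta> powr (1/s)" "1/2"] assms by auto
  have "((1/2) ^ m) powr s \<le> (\<eta> powr (1/s)) powr s"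
    using m assms by (intro powr_mono2) auto
  then show ?thesis using True assms by (auto simp: powr_powr intro!: exI[of _ m])
next
  case False
  then have D: "D > 0" using assms by simp
  have ex: "\<exists>m::nat. (1/2) ^ m \<le> D"
    using real_arch_pow_inv[OF D, of "1/2"] less_imp_le by auto
  define k where "k = (LEAST m::nat. (1/2) ^ m \<le> D)"
  have k: "(1/2) ^ k \<le> D" unfolding k_def using ex by (rule LeastI_ex)
  have "k \<noteq> 0" using k assms by (intro notI) auto
  then obtain m where m: "k = Suc m" using not0_implies_Suc by blast
  have "\<not> (1/2) ^ m \<le> D" using not_less_Least[of m "\<lambda>m. (1/2) ^ m \<le> D"] m by (simp add: k_def)
  moreover have "((1/2) ^ m) powr s \<le> (2 * D) powr s"
    using k m assms by (intro powr_mono2) auto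
  ultimately show ?thesis using assms by (auto simp: powr_mult intro!: exI[of _ m])
qed

text \<open>The mass distribution principle, in the form of a Cauchy--Schwarz inequality. A set of
  diameter less than \<open>2\<^sup>-\<^sup>m\<close> lies in an open box that meets at most \<open>3\<^sup>d\<close> dyadic cubes of level
  \<open>m\<close>. By compactness a cover of \<open>\<Inter>j. K j\<close> therefore yields finitely many dyadic cubes that
  cover some \<open>K j\<close>, which carries the mass of \<open>f j\<close>; the mass of \<open>f j\<close> on these cubes is
  at most the square root of \<open>\<Sum>2\<^sup>-\<^sup>s\<^sup>m\<close> times the dyadic norm of \<open>f j\<close>. Because of compactness
  the argument can stay with the densities \<open>f j\<close> and avoids a limit measure on the intersection.\<close>

lemma hausdorff_measure_pos_of_dyadic_norm:
  fixes K :: "nat \<Rightarrow> (real ^ 'n) set"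
  assumes s: "0 < s" and c: "0 < c"
    and compact: "\<And>j. compact (K j)" and dec: "\<And>j. K (Suc j) \<subseteq> K j"
    and int: "\<And>j. integrable lborel (f j)" and nonneg: "\<And>j x. 0 \<le> f j x"
    and supp: "\<And>j x. f j x \<noteq> 0 \<Longrightarrow> x \<in> K j \<and> x \<in> unit_cube"
    and mass: "\<And>j. c \<le> (\<integral>x. f j x \<partial>lborel)"
    and norm: "\<And>j L. dyadic_norm s L (f j) \<le> B"
  shows "hausdorff_measure s (\<Inter>j. K j) \<noteq> 0"
proof
  assume null: "hausdorff_measure s (\<Inter>j. K j) = 0"
  define C where "C = (3::real) ^ CARD('n) * (2 powr s + 1)"
  (* small enough that C * \<epsilon> * B\<^sup>2, the bound for c\<^sup>2 obtained in the end, is less than c\<^sup>2 *)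
  define \<epsilon> where "\<epsilon> = c\<^sup>2 / (2 * C * (B\<^sup>2 + 1))"
  have C: "C > 0" unfolding C_def by (simp add: add_pos_pos)
  have \<epsilon>: "\<epsilon> > 0" unfolding \<epsilon>_def using c C by (intro divide_pos_pos mult_pos_pos) (auto simp: add_nonneg_pos)
  have "hausdorff_premeasure s (1/2) (\<Inter>j. K j) < ennreal \<epsilon>"
    using null \<epsilon> by (simp add: hausdorff_measure_eq_0_iff)
  then obtain U where cov: "(\<Inter>j. K j) \<subseteq> (\<Union>k. U k)"
    and U: "\<And>k. bounded (U k)" "\<And>k. diameter (U k) \<le> 1/2"
    and sumU: "(\<Sum>k. ennreal (hausdorff_gauge s (U k))) < ennreal \<epsilon>"
    unfolding hausdorff_premeasure_def INF_less_iff by auto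
  have "\<exists>m::nat. diameter (U k) < (1/2) ^ m \<and>
      ((1/2) ^ m) powr s \<le> 2 powr s * diameter (U k) powr s + \<epsilon> * (1/2) ^ Suc k" for k
    using U(2)[of k] diameter_ge_0[OF U(1), of k] s \<epsilon> by (intro dyadic_scale_exists) auto
  then obtain m where m: "\<And>k. diameter (U k) < (1/2) ^ m k"
    "\<And>k. ((1/2) ^ m k) powr s \<le> 2 powr s * diameter (U k) powr s + \<epsilon> * (1/2) ^ Suc k"
    by metis
  define u where "u k = (SOME x. x \<in> U k)" for k
  define V where "V k = (if U k = {} then {} else
      box (\<chi> i. u k $ i - (1/2) ^ m k) (\<chi> i. u k $ i + (1/2) ^ m k))" for k
  have V_open: "open (V k)" for k by (simp add: V_def open_box)
  have UV: "U k \<subseteq> V k" for k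
  proof
    fix x assume x: "x \<in> U k"
    then have uk: "u k \<in> U k" unfolding u_def by (rule someI)
    have "\<bar>x $ i - u k $ i\<bar> < (1/2) ^ m k" for i
    proof -
      have "\<bar>(x - u k) $ i\<bar> \<le> dist x (u k)" unfolding dist_norm by (rule component_le_norm_cart)
      also have "\<dots> \<le> diameter (U k)" by (rule diameter_bounded_bound[OF U(1) x uk])
      finally show ?thesis using m(1)[of k] by simp
    qed
    then show "x \<in> V k" using x unfolding V_def by (auto simp: mem_box_cart abs_less_iff algebra_simps)
  qed
  define F where "F k = {a \<in> dyadic_indices (\<lambda>_. m k). \<forall>i. a i \<in> {\<lfloor>2 ^ m k * u k $ i\<rfloor> - 1 .. \<lfloor>2 ^ m k * u k $ i\<rfloor> + 1}}" for k
  have finF: "finite (F k)" for k unfolding F_def by simp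
  have cardF: "real (card (F k)) \<le> 3 ^ CARD('n)" for k
  proof -
    have "card (F k) \<le> card (PiE UNIV (\<lambda>i. {\<lfloor>2 ^ m k * u k $ i\<rfloor> - 1 .. \<lfloor>2 ^ m k * u k $ i\<rfloor> + 1}))"
      by (intro card_mono finite_PiE) (auto simp: F_def PiE_UNIV_domain)
    also have "\<dots> = 3 ^ CARD('n)" by (simp add: card_PiE)
    finally show ?thesis by (metis of_nat_le_iff of_nat_numeral of_nat_power)
  qed
  have VF: "dyadic_index (\<lambda>_. m k) x \<in> F k" if "x \<in> V k" "x \<in> unit_cube" for k x
  proof -
    have "\<lfloor>2 ^ m k * x $ i\<rfloor> \<in> {\<lfloor>2 ^ m k * u k $ i\<rfloor> - 1 .. \<lfloor>2 ^ m k * u k $ i\<rfloor> + 1}" for i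
    proof -
      have "\<bar>x $ i - u k $ i\<bar> < (1/2) ^ m k"
        using that(1) by (auto simp: V_def mem_box_cart abs_less_iff algebra_simps split: if_splits)
      then have "2 ^ m k * \<bar>x $ i - u k $ i\<bar> < 1"
        by (simp add: power_divide field_simps)
      then have "\<bar>2 ^ m k * x $ i - 2 ^ m k * u k $ i\<bar> < 1"
        by (simp add: abs_mult flip: right_diff_distrib)
      then show ?thesis by (simp, linarith)
    qed
    then show ?thesis using that(2) dyadic_index_mem_iff[of "\<lambda>_. m k" x] by (simp add: F_def dyadic_index_def)
  qed
  (* the compact sets K j minus the open cover decrease to the empty set *)
  obtain j where j: "K j \<subseteq> (\<Union>k. V k)"
  proof (rule ccontr)
    assume "\<not> thesis"
    then have ne: "K j - (\<Union>k. V k) \<noteq> {}" for j using that by blast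
    have "K n \<subseteq> K k" if "k \<le> n" for k n by (rule lift_Suc_antimono_le[of K, OF dec that])
    then have "(\<Inter>j. K j - (\<Union>k. V k)) \<noteq> {}"
      using ne by (intro compact_nest compact_diff compact open_UN) (auto simp: V_open)
    then obtain x where "x \<in> (\<Inter>j. K j - (\<Union>k. V k))" by (meson ex_in_conv)
    then have x: "x \<in> (\<Inter>j. K j)" "x \<notin> (\<Union>k. V k)" by auto
    then obtain k where "x \<in> U k" using cov by auto
    with UV[of k] x(2) show False by auto
  qed
  obtain I where I: "finite I" "K j \<subseteq> (\<Union>k\<in>I. V k)"
    by (rule compactE_image[OF compact V_open j])
  define G where "G = (\<lambda>(k,a). (m k, a)) ` (SIGMA k:I. F k)"
  have finG: "finite G" unfolding G_def using I(1) finF by auto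
  have Gmem: "\<exists>(n,a)\<in>G. x \<in> dyadic_cube n a" if "f j x \<noteq> 0" for x
  proof -
    have x: "x \<in> K j" "x \<in> unit_cube" using supp[OF that] by auto
    then obtain k where k: "k \<in> I" "x \<in> V k" using I(2) by blast
    have "(m k, dyadic_index (\<lambda>_. m k) x) \<in> G"
      unfolding G_def using k VF[OF k(2) x(2)] by force
    then show ?thesis by (force simp: mem_dyadic_box_iff)
  qed
  have int': "integrable lborel (\<lambda>x. indicator (dyadic_cube n a) x * f j x)" for n a
    using integrable_real_mult_indicator[OF _ int, of "dyadic_cube n a" j] by (simp add: mult.commute)
  have "c \<le> (\<integral>x. f j x \<partial>lborel)" by (rule mass)
  also have "\<dots> \<le> (\<integral>x. (\<Sum>(n,a)\<in>G. indicator (dyadic_cube n a) x * f j x) \<partial>lborel)"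
  proof (rule integral_mono[OF int])
    show "integrable lborel (\<lambda>x. \<Sum>(n,a)\<in>G. indicator (dyadic_cube n a) x * f j x)"
      by (intro Bochner_Integration.integrable_sum) (auto simp: int')
    fix x
    show "f j x \<le> (\<Sum>(n,a)\<in>G. indicator (dyadic_cube n a) x * f j x)"
    proof (cases "f j x = 0")
      case False
      then obtain n a where na: "(n,a) \<in> G" "x \<in> dyadic_cube n a" using Gmem by blast
      have "(\<lambda>(n,a). indicator (dyadic_cube n a) x * f j x) (n,a) \<le> (\<Sum>(n,a)\<in>G. indicator (dyadic_cube n a) x * f j x)"
        by (rule member_le_sum) (use na finG nonneg in auto)
      then show ?thesis using na by simp
    qed (auto intro!: sum_nonneg)
  qed
  also have "\<dots> = (\<Sum>(n,a)\<in>G. dyadic_mass (f j) n a)"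
    by (subst Bochner_Integration.integral_sum) (auto simp: int' dyadic_mass_def intro!: sum.cong)
  also have "\<dots> = (\<Sum>g\<in>G. 2 powr (- (s * fst g) / 2) * (2 powr (s * fst g / 2) * dyadic_mass (f j) (fst g) (snd g)))"
    by (intro sum.cong) (auto simp: powr_add[symmetric] mult.assoc[symmetric])
  finally have "c\<^sup>2 \<le> (\<Sum>g\<in>G. 2 powr (- (s * fst g) / 2) * (2 powr (s * fst g / 2) * dyadic_mass (f j) (fst g) (snd g)))\<^sup>2"
    using c by (intro power_mono) auto
  also have "\<dots> \<le> (\<Sum>g\<in>G. (2 powr (- (s * fst g) / 2))\<^sup>2) * (\<Sum>g\<in>G. (2 powr (s * fst g / 2) * dyadic_mass (f j) (fst g) (snd g))\<^sup>2)"
    by (rule Cauchy_Schwarz_ineq_sum)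
  also have "\<dots> \<le> (C * \<epsilon>) * B\<^sup>2"
  proof (intro mult_mono)
    have "(\<Sum>g\<in>G. (2 powr (- (s * fst g) / 2))\<^sup>2) = (\<Sum>g\<in>G. ((1/2) ^ fst g) powr s)"
    proof (intro sum.cong refl)
      fix g :: "nat \<times> ('n \<Rightarrow> int)"
      have "(1/2) ^ fst g = (2::real) powr (- real (fst g))"
        by (simp add: powr_minus powr_realpow power_divide inverse_eq_divide)
      then show "(2 powr (- (s * fst g) / 2))\<^sup>2 = ((1/2) ^ fst g) powr s"
        by (simp add: powr_powr power2_eq_square mult.commute flip: powr_add)
    qed
    also have "\<dots> \<le> (\<Sum>(k,a)\<in>(SIGMA k:I. F k). ((1/2) ^ m k) powr s)"
      unfolding G_def by (rule order_trans[OF sum_image_le]) (use I finF in \<open>auto simp: case_prod_unfold o_def\<close>)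
    also have "\<dots> = (\<Sum>k\<in>I. real (card (F k)) * ((1/2) ^ m k) powr s)"
      using I(1) finF by (subst sum.Sigma[symmetric]) auto
    also have "\<dots> \<le> (\<Sum>k\<in>I. 3 ^ CARD('n) * (if F k = {} then 0 else ((1/2) ^ m k) powr s))"
      using cardF by (intro sum_mono) (auto intro: mult_right_mono)
    also have "\<dots> \<le> (\<Sum>k\<in>I. 3 ^ CARD('n) * (2 powr s * diameter (U k) powr s + \<epsilon> * (1/2) ^ Suc k))"
      using m(2) \<epsilon> by (intro sum_mono mult_left_mono) (auto intro!: add_nonneg_nonneg)
    also have "\<dots> = 3 ^ CARD('n) * (2 powr s * (\<Sum>k\<in>I. diameter (U k) powr s) + \<epsilon> * (\<Sum>k\<in>I. (1/2) ^ Suc k))"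
      by (simp only: sum_distrib_left[symmetric] sum.distrib)
    also have "\<dots> \<le> 3 ^ CARD('n) * (2 powr s * \<epsilon> + \<epsilon> * 1)"
    proof (intro mult_left_mono add_mono)
      have eq: "(\<Sum>k\<in>I. diameter (U k) powr s) = (\<Sum>k\<in>I. hausdorff_gauge s (U k))"
        using s by (intro sum.cong) (auto simp: hausdorff_gauge_def diameter_def)
      have "ennreal (\<Sum>k\<in>I. hausdorff_gauge s (U k)) = (\<Sum>k\<in>I. ennreal (hausdorff_gauge s (U k)))"
        by (simp add: hausdorff_gauge_nonneg)
      also have "\<dots> \<le> (\<Sum>k. ennreal (hausdorff_gauge s (U k)))"
        by (rule sum_le_suminf) (use I(1) in auto)
      also have "\<dots> < ennreal \<epsilon>" by (rule sumU)
      finally have "(\<Sum>k\<in>I. hausdorff_gauge s (U k)) < \<epsilon>"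
        by (rule ennreal_less_iff[THEN iffD1, rotated]) (simp add: hausdorff_gauge_nonneg sum_nonneg)
      then show "(\<Sum>k\<in>I. diameter (U k) powr s) \<le> \<epsilon>" unfolding eq by simp
      have "(\<Sum>k\<in>I. (1/2::real) ^ Suc k) \<le> (\<Sum>k. (1/2) ^ Suc k)"
        using power_half_series I(1) by (intro sum_le_suminf) (auto simp: sums_iff)
      then show "(\<Sum>k\<in>I. (1/2::real) ^ Suc k) \<le> 1" using power_half_series by (simp add: sums_iff)
    qed (use \<epsilon> in auto)
    also have "\<dots> = C * \<epsilon>" by (simp add: C_def algebra_simps)
    finally show "(\<Sum>g\<in>G. (2 powr (- (s * fst g) / 2))\<^sup>2) \<le> C * \<epsilon>" .
    obtain L where L: "fst ` G \<subseteq> {..<L}" using finite_nat_iff_bounded finG by blast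
    have "(\<Sum>g\<in>G. (2 powr (s * fst g / 2) * dyadic_mass (f j) (fst g) (snd g))\<^sup>2)
       \<le> (\<Sum>g\<in>(SIGMA m:{..<L}. dyadic_indices (\<lambda>_. m)). (2 powr (s * fst g / 2) * dyadic_mass (f j) (fst g) (snd g))\<^sup>2)"
    proof (rule sum_mono2)
      show "G \<subseteq> (SIGMA m:{..<L}. dyadic_indices (\<lambda>_. m))"
        using L by (force simp: G_def F_def)
    qed auto
    also have "\<dots> = (dyadic_norm s L (f j))\<^sup>2"
      unfolding dyadic_norm_def L2_set_def by (subst real_sqrt_pow2) (auto intro!: sum_nonneg simp: case_prod_unfold)
    also have "\<dots> \<le> B\<^sup>2" using norm by (intro power_mono) (auto simp: dyadic_norm_def L2_set_nonneg)
    finally show "(\<Sum>g\<in>G. (2 powr (s * fst g / 2) * dyadic_mass (f j) (fst g) (snd g))\<^sup>2) \<le> B\<^sup>2" .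
  qed (use C \<epsilon> in \<open>auto intro!: sum_nonneg\<close>)
  also have "\<dots> = c\<^sup>2 / 2 * (B\<^sup>2 / (B\<^sup>2 + 1))" using C by (simp add: \<epsilon>_def)
  also have "\<dots> \<le> c\<^sup>2 / 2 * 1"
    by (intro mult_left_mono) (auto simp: divide_le_eq_1 add_nonneg_pos)
  also have "\<dots> < c\<^sup>2" using c by simp
  finally show False by simp
qed

section \<open>Intersecting a sequence of well distributed sets\<close>

definition bounded_borel :: "('a::euclidean_space \<Rightarrow> real) \<Rightarrow> bool" where
  "bounded_borel f \<longleftrightarrow> f \<in> borel_measurable borel \<and> (\<exists>B. \<forall>x. \<bar>f x\<bar> \<le> B)"

definition dyadic_step :: "nat \<Rightarrow> (real ^ 'n \<Rightarrow> real) \<Rightarrow> bool" where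
  "dyadic_step M f \<longleftrightarrow> (\<forall>x y. dyadic_index (\<lambda>_. M) x = dyadic_index (\<lambda>_. M) y \<longrightarrow> f x = f y)"

lemma bounded_borel_measurable: "bounded_borel f \<Longrightarrow> f \<in> borel_measurable borel"
  by (simp add: bounded_borel_def)

lemma bounded_borel_const [simp]: "bounded_borel (\<lambda>x. c)"
  by (auto simp: bounded_borel_def)

lemma bounded_borel_indicator: "S \<in> sets borel \<Longrightarrow> bounded_borel (indicator S)"
  by (auto simp: bounded_borel_def indicator_def intro!: exI[of _ 1])

lemma bounded_borel_mult:
  assumes "bounded_borel f" "bounded_borel g"
  shows "bounded_borel (\<lambda>x. f x * g x)"
proof -
  obtain A B where "\<And>x. \<bar>f x\<bar> \<le> A" "\<And>x. \<bar>g x\<bar> \<le> B" using assms by (auto simp: bounded_borel_def)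
  then have "\<bar>f x * g x\<bar> \<le> A * B" for x
    by (simp add: abs_mult) (meson abs_ge_zero mult_mono order_trans)
  then show ?thesis using assms by (auto simp: bounded_borel_def)
qed

lemma bounded_borel_diff:
  assumes "bounded_borel f" "bounded_borel g"
  shows "bounded_borel (\<lambda>x. f x - g x)"
proof -
  obtain A B where "\<And>x. \<bar>f x\<bar> \<le> A" "\<And>x. \<bar>g x\<bar> \<le> B" using assms by (auto simp: bounded_borel_def)
  then have "\<bar>f x - g x\<bar> \<le> A + B" for x
    by (meson abs_triangle_ineq4 add_mono order_trans)
  then show ?thesis using assms by (auto simp: bounded_borel_def)
qed

lemma integrable_dyadic_cube_times:
  assumes "bounded_borel f"
  shows "integrable lborel (\<lambda>x. indicator (dyadic_cube m a) x * f x)"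
proof -
  obtain B where B: "\<And>x. \<bar>f x\<bar> \<le> B" using assms by (auto simp: bounded_borel_def)
  have [measurable]: "f \<in> borel_measurable borel" using assms by (rule bounded_borel_measurable)
  have "integrable lborel (\<lambda>x. B * indicator (dyadic_cube m a) x :: real)"
    by (intro integrable_mult_right integrable_real_indicator) (auto simp: emeasure_dyadic_box)
  then show ?thesis
  proof (rule Bochner_Integration.integrable_bound)
    have "norm (indicator (dyadic_cube m a) x * f x) \<le> norm (B * indicator (dyadic_cube m a) x)" for x
      using B[of x] by (simp add: indicator_def)
    then show "AE x in lborel. norm (indicator (dyadic_cube m a) x * f x) \<le> norm (B * indicator (dyadic_cube m a) x)"
      by simp
  qed simp
qed

lemma unit_cube_conv_dyadic_cube: "unit_cube = dyadic_cube 0 (\<lambda>_. 0)"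
  by (auto simp: unit_cube_def dyadic_box_def dyadic_index_def fun_eq_iff floor_eq_iff)

lemma integrable_on_unit_cube:
  assumes "bounded_borel f" "\<And>x. f x \<noteq> 0 \<Longrightarrow> x \<in> unit_cube"
  shows "integrable lborel f" "(\<integral>x. f x \<partial>lborel) = dyadic_mass f 0 (\<lambda>_. 0)"
proof -
  have eq: "(\<lambda>x. indicator (dyadic_cube 0 (\<lambda>_. 0)) x * f x) = f"
    using assms(2) by (auto simp: unit_cube_conv_dyadic_cube[symmetric] indicator_def fun_eq_iff)
  show "integrable lborel f" using integrable_dyadic_cube_times[OF assms(1), of 0 "\<lambda>_. 0"] by (simp add: eq)
  show "(\<integral>x. f x \<partial>lborel) = dyadic_mass f 0 (\<lambda>_. 0)" by (simp add: dyadic_mass_def eq)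
qed

lemma dyadic_mass_add:
  assumes "bounded_borel f" "bounded_borel g"
  shows "dyadic_mass (\<lambda>x. f x + g x) m a = dyadic_mass f m a + dyadic_mass g m a"
  unfolding dyadic_mass_def
  using Bochner_Integration.integral_add[OF integrable_dyadic_cube_times[OF assms(1), of m a] integrable_dyadic_cube_times[OF assms(2), of m a]]
  by (simp add: algebra_simps)

lemma dyadic_norm_triangle:
  assumes "bounded_borel f" "bounded_borel g"
  shows "dyadic_norm s L (\<lambda>x. f x + g x) \<le> dyadic_norm s L f + dyadic_norm s L g"
  unfolding dyadic_norm_def
  by (rule order_trans[OF eq_refl L2_set_triangle_ineq])
     (simp add: dyadic_mass_add[OF assms] case_prod_unfold algebra_simps)

lemma L2_set_abs: "L2_set (\<lambda>x. \<bar>f x\<bar>) S = L2_set f S"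
  by (simp add: L2_set_def)

lemma dyadic_mass_le_norm:
  assumes "0 < s" "m < L" "a \<in> dyadic_indices (\<lambda>_. m)"
  shows "\<bar>dyadic_mass f m a\<bar> \<le> dyadic_norm s L f"
proof -
  have "\<bar>dyadic_mass f m a\<bar> \<le> 2 powr (s * m / 2) * \<bar>dyadic_mass f m a\<bar>"
    using assms by (simp add: mult_le_cancel_right1 ge_one_powr_ge_zero)
  also have "\<dots> = \<bar>(\<lambda>(m,a). 2 powr (s * m / 2) * dyadic_mass f m a) (m, a)\<bar>" by (simp add: abs_mult)
  also have "\<dots> \<le> L2_set (\<lambda>x. \<bar>(\<lambda>(m,a). 2 powr (s * m / 2) * dyadic_mass f m a) x\<bar>) (SIGMA m:{..<L}. dyadic_indices (\<lambda>_. m))"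
    by (rule member_le_L2_set) (use assms in auto)
  finally show ?thesis by (simp add: dyadic_norm_def L2_set_abs)
qed

lemma dyadic_mass_step_times_fine:
  assumes F: "dyadic_step M F" "\<And>x. \<bar>F x\<bar> \<le> B" and m: "M \<le> m"
  shows "\<bar>dyadic_mass (\<lambda>x. F x * h x) m a\<bar> \<le> B * \<bar>dyadic_mass h m a\<bar>"
proof -
  define x0 where "x0 = (SOME x. x \<in> dyadic_cube m a)"
  have "indicator (dyadic_cube m a) x * (F x * h x) = F x0 * (indicator (dyadic_cube m a) x * h x)" for x
  proof (cases "x \<in> dyadic_cube m a")
    case True
    then have "x0 \<in> dyadic_cube m a" unfolding x0_def by (rule someI)
    then have "dyadic_index (\<lambda>_. m) x = dyadic_index (\<lambda>_. m) x0" using True by (simp add: mem_dyadic_box_iff)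
    then have "dyadic_index (\<lambda>_. M) x = dyadic_index (\<lambda>_. M) x0" 
      by (rule dyadic_index_coarsen[rotated]) (rule m)
    then have "F x = F x0" using F(1) unfolding dyadic_step_def by blast
    then show ?thesis by simp
  qed simp
  then have "dyadic_mass (\<lambda>x. F x * h x) m a = F x0 * dyadic_mass h m a"
    unfolding dyadic_mass_def by (simp only: Bochner_Integration.integral_mult_right_zero)
  then show ?thesis using F(2)[of x0] by (simp add: abs_mult mult_right_mono)
qed

lemma integral_step_times:
  fixes F :: "real ^ 'n \<Rightarrow> real"
  assumes F: "dyadic_step M F" "\<And>x. \<bar>F x\<bar> \<le> B" "bounded_borel F" "\<And>x. F x \<noteq> 0 \<Longrightarrow> x \<in> unit_cube"
    and h: "bounded_borel h"
  shows "\<bar>\<integral>x. F x * h x \<partial>lborel\<bar> \<le> (\<Sum>b\<in>dyadic_indices (\<lambda>_. M). B * \<bar>dyadic_mass h M b\<bar>)"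
proof -
  have "(\<Sum>b\<in>dyadic_indices (\<lambda>_. M). indicator (dyadic_cube M b) x * (F x * h x)) = F x * h x" for x
  proof (cases "F x = 0")
    case False
    have "(\<Sum>b\<in>dyadic_indices (\<lambda>_. M). indicator (dyadic_cube M b) x * (F x * h x))
       = (\<Sum>b\<in>dyadic_indices (\<lambda>_. M). if b = dyadic_index (\<lambda>_. M) x then F x * h x else 0)"
      by (intro sum.cong) (auto simp: indicator_def mem_dyadic_box_iff)
    then show ?thesis using F(4)[OF False] by (simp add: dyadic_index_mem_iff)
  qed simp
  then have "(\<integral>x. F x * h x \<partial>lborel)
     = (\<integral>x. (\<Sum>b\<in>dyadic_indices (\<lambda>_. M). indicator (dyadic_cube M b) x * (F x * h x)) \<partial>lborel)" by (simp only:)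
  also have "\<dots> = (\<Sum>b\<in>dyadic_indices (\<lambda>_. M). dyadic_mass (\<lambda>x. F x * h x) M b)"
    unfolding dyadic_mass_def
    by (rule Bochner_Integration.integral_sum) (intro integrable_dyadic_cube_times bounded_borel_mult F h)
  finally show ?thesis
    by (auto intro!: order_trans[OF sum_abs] sum_mono dyadic_mass_step_times_fine F)
qed

text \<open>Multiplication by a step function is bounded for the dyadic norm. On cubes finer than the
  steps of \<open>f\<close> it is multiplication by a constant; the finitely many coarser cubes contribute at
  most \<open>\<delta>\<close> times a constant depending only on \<open>f\<close>, because their masses are combinations of
  the masses at level \<open>M\<close>.\<close>

lemma dyadic_norm_step_times:
  fixes f :: "real ^ 'n \<Rightarrow> real"
  assumes s: "0 < s" and f: "dyadic_step M f" "bounded_borel f"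
  shows "\<exists>C\<ge>0. \<forall>h \<delta>. bounded_borel h \<longrightarrow> (\<forall>L. dyadic_norm s L h \<le> \<delta>) \<longrightarrow>
    (\<forall>L. dyadic_norm s L (\<lambda>x. f x * h x) \<le> C * \<delta>)"
proof -
  obtain B where B: "\<And>x. \<bar>f x\<bar> \<le> B" using f by (auto simp: bounded_borel_def)
  have B0: "B \<ge> 0" using order_trans[OF abs_ge_zero B] .
  define N where "N = real (card (dyadic_indices (\<lambda>_::'n. M)))"
  define S where "S L = (SIGMA m:{..<L}. dyadic_indices (\<lambda>_::'n. m))" for L
  define c where "c = 2 powr (s * M / 2) * (N * B)"
  have c0: "c \<ge> 0" unfolding c_def N_def using B0 by simp
  show ?thesis
  proof (intro exI[of _ "B + real (card (S M)) * c"] conjI allI impI)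
    show "0 \<le> B + real (card (S M)) * c" using B0 c0 by simp
    fix h :: "real ^ 'n \<Rightarrow> real" and \<delta> L
    assume h: "bounded_borel h" and \<delta>: "\<forall>L. dyadic_norm s L h \<le> \<delta>"
    have \<delta>0: "\<delta> \<ge> 0" using \<delta>[rule_format, of 0] by (simp add: dyadic_norm_def)
    have coarse: "\<bar>dyadic_mass (\<lambda>x. f x * h x) m a\<bar> \<le> N * (B * \<delta>)"
      if "m < M" "a \<in> dyadic_indices (\<lambda>_. m)" for m a
    proof -
      (* the indicator of a coarse cube is itself a step function of level M *)
      define F where "F x = indicator (dyadic_cube m a) x * f x" for x
      have "\<bar>\<integral>x. F x * h x \<partial>lborel\<bar> \<le> (\<Sum>b\<in>dyadic_indices (\<lambda>_. M). B * \<bar>dyadic_mass h M b\<bar>)"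
      proof (rule integral_step_times[OF _ _ _ _ h])
        show "dyadic_step M F"
          unfolding dyadic_step_def
        proof (intro allI impI)
          fix x y :: "real ^ 'n" assume xy: "dyadic_index (\<lambda>_. M) x = dyadic_index (\<lambda>_. M) y"
          then have "dyadic_index (\<lambda>_. m) x = dyadic_index (\<lambda>_. m) y"
            by (rule dyadic_index_coarsen[rotated]) (use \<open>m < M\<close> in simp)
          moreover have "f x = f y" using f(1) xy unfolding dyadic_step_def by blast
          ultimately show "F x = F y" by (simp add: F_def indicator_def mem_dyadic_box_iff)
        qed
        show "\<bar>F x\<bar> \<le> B" for x using B[of x] B0 by (simp add: F_def indicator_def)
        show "bounded_borel F" unfolding F_def by (intro bounded_borel_mult bounded_borel_indicator f) simp
        show "F x \<noteq> 0 \<Longrightarrow> x \<in> unit_cube" for x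
          using dyadic_box_subset_unit_cube[OF that(2)] by (auto simp: F_def indicator_def split: if_splits)
      qed
      also have "\<dots> \<le> (\<Sum>b\<in>dyadic_indices (\<lambda>_::'n. M). B * \<delta>)"
        using dyadic_mass_le_norm[OF s, of M "Suc M" _ h] \<delta>
        by (intro sum_mono mult_left_mono B0) (meson lessI order_trans)
      finally show ?thesis by (simp add: F_def dyadic_mass_def N_def mult.assoc)
    qed
    have "dyadic_norm s L (\<lambda>x. f x * h x)
        = L2_set (\<lambda>x. \<bar>2 powr (s * fst x / 2) * dyadic_mass (\<lambda>x. f x * h x) (fst x) (snd x)\<bar>) (S L)"
      by (simp add: dyadic_norm_def S_def L2_set_abs case_prod_unfold)
    also have "\<dots> \<le> L2_set (\<lambda>x. B * \<bar>2 powr (s * fst x / 2) * dyadic_mass h (fst x) (snd x)\<bar> + (if fst x < M then c * \<delta> else 0)) (S L)"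
    proof (rule L2_set_mono)
      fix x assume x: "x \<in> S L"
      obtain m a where [simp]: "x = (m, a)" by (cases x)
      have a: "a \<in> dyadic_indices (\<lambda>_. m)" using x by (simp add: S_def)
      show "\<bar>2 powr (s * fst x / 2) * dyadic_mass (\<lambda>x. f x * h x) (fst x) (snd x)\<bar>
        \<le> B * \<bar>2 powr (s * fst x / 2) * dyadic_mass h (fst x) (snd x)\<bar> + (if fst x < M then c * \<delta> else 0)"
      proof (cases "m < M")
        case True
        have "2 powr (s * m / 2) * \<bar>dyadic_mass (\<lambda>x. f x * h x) m a\<bar> \<le> 2 powr (s * M / 2) * (N * (B * \<delta>))"
          using coarse[OF True a] True s by (intro mult_mono) auto
        then show ?thesis using True B0 by (simp add: abs_mult c_def mult_ac add_increasing)
      next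
        case False
        have "\<bar>dyadic_mass (\<lambda>x. f x * h x) m a\<bar> \<le> B * \<bar>dyadic_mass h m a\<bar>"
          using False by (intro dyadic_mass_step_times_fine[OF f(1) B]) auto
        then have "2 powr (s * m / 2) * \<bar>dyadic_mass (\<lambda>x. f x * h x) m a\<bar> \<le> 2 powr (s * m / 2) * (B * \<bar>dyadic_mass h m a\<bar>)"
          by (intro mult_left_mono) auto
        then show ?thesis using False by (simp add: abs_mult mult_ac)
      qed
    qed simp
    also have "\<dots> \<le> L2_set (\<lambda>x. B * \<bar>2 powr (s * fst x / 2) * dyadic_mass h (fst x) (snd x)\<bar>) (S L)
        + L2_set (\<lambda>x. if fst x < M then c * \<delta> else 0) (S L)"
      by (rule L2_set_triangle_ineq)
    also have "\<dots> \<le> B * \<delta> + real (card (S M)) * (c * \<delta>)"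
    proof (rule add_mono)
      have "L2_set (\<lambda>x. B * \<bar>2 powr (s * fst x / 2) * dyadic_mass h (fst x) (snd x)\<bar>) (S L) = B * dyadic_norm s L h"
        by (simp add: L2_set_right_distrib[OF B0, symmetric] L2_set_abs dyadic_norm_def S_def case_prod_unfold)
      also have "\<dots> \<le> B * \<delta>" using \<delta> B0 by (intro mult_left_mono) auto
      finally show "L2_set (\<lambda>x. B * \<bar>2 powr (s * fst x / 2) * dyadic_mass h (fst x) (snd x)\<bar>) (S L) \<le> B * \<delta>" .
      have fin: "finite (S L)" for L unfolding S_def by auto
      have "L2_set (\<lambda>x. if fst x < M then c * \<delta> else 0) (S L) \<le> (\<Sum>x\<in>S L. if fst x < M then c * \<delta> else 0)"
        by (rule L2_set_le_sum) (use c0 \<delta>0 in auto)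
      also have "\<dots> = (\<Sum>x\<in>{x \<in> S L. fst x < M}. c * \<delta>)"
        by (rule sum.inter_filter[symmetric]) (rule fin)
      also have "\<dots> \<le> (\<Sum>x\<in>S M. c * \<delta>)"
        by (rule sum_mono2) (use fin c0 \<delta>0 in \<open>auto simp: S_def\<close>)
      finally show "L2_set (\<lambda>x. if fst x < M then c * \<delta> else 0) (S L) \<le> real (card (S M)) * (c * \<delta>)" by simp
    qed
    finally show "dyadic_norm s L (\<lambda>x. f x * h x) \<le> (B + real (card (S M)) * c) * \<delta>"
      by (simp add: algebra_simps)
  qed
qed

text \<open>Lebesgue measure has finite \<open>s\<close>-energy for \<open>s\<close> below the dimension \<open>d\<close>: the \<open>2\<^sup>d\<^sup>m\<close> cubes of level
  \<open>m\<close> have mass \<open>2\<^sup>-\<^sup>d\<^sup>m\<close> and contribute \<open>2 powr ((s - d) * m)\<close>.\<close>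

lemma dyadic_norm_indicator_bounded:
  fixes S :: "(real ^ 'n) set" and s :: real
  assumes s: "s < CARD('n)" and [measurable]: "S \<in> sets borel"
  shows "\<exists>B. \<forall>L. dyadic_norm s L (indicator S) \<le> B"
proof (intro exI allI)
  define q where "q = 2 powr (s - CARD('n))"
  have q: "0 < q" "q < 1" using s powr_less_mono[of "s - CARD('n)" 0 2] by (auto simp: q_def)
  fix L
  have mass: "0 \<le> dyadic_mass (indicator S) m a \<and> dyadic_mass (indicator S) m a \<le> 1 / 2 ^ (m * CARD('n))"
    for m and a :: "'n \<Rightarrow> int"
  proof -
    have "dyadic_mass (indicator S) m a = measure lborel (dyadic_cube m a \<inter> S)"
      by (simp add: dyadic_mass_def indicator_inter_arith[symmetric])
    moreover have "measure lborel (dyadic_cube m a \<inter> S) \<le> measure lborel (dyadic_cube m a)"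
      by (intro measure_mono_fmeasurable) (auto simp: fmeasurable_def emeasure_dyadic_box)
    ultimately show ?thesis by (simp add: measure_dyadic_box power_divide power_mult)
  qed
  have "(dyadic_norm s L (indicator S))\<^sup>2
     = (\<Sum>(m,a)\<in>(SIGMA m:{..<L}. dyadic_indices (\<lambda>_::'n. m)). (2 powr (s * m / 2) * dyadic_mass (indicator S) m a)\<^sup>2)"
    unfolding dyadic_norm_def L2_set_def by (subst real_sqrt_pow2) (auto intro!: sum_nonneg simp: case_prod_unfold)
  also have "\<dots> = (\<Sum>m<L. \<Sum>a\<in>dyadic_indices (\<lambda>_::'n. m). (2 powr (s * m / 2) * dyadic_mass (indicator S) m a)\<^sup>2)"
    by (rule sum.Sigma[symmetric]) auto
  also have "\<dots> \<le> (\<Sum>m<L. \<Sum>a\<in>dyadic_indices (\<lambda>_::'n. m). (2 powr (s * m / 2) * (1 / 2 ^ (m * CARD('n))))\<^sup>2)"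
    using mass by (intro sum_mono power_mono mult_left_mono mult_nonneg_nonneg) auto
  also have "\<dots> = (\<Sum>m<L. q ^ m)"
  proof (rule sum.cong[OF refl])
    fix m
    have "(2 powr (s * m / 2))\<^sup>2 = (2 powr s) ^ m"
      by (simp add: power2_eq_square powr_realpow[symmetric] powr_powr flip: powr_add)
    then have "(2 powr (s * m / 2) * (1 / 2 ^ (m * CARD('n))))\<^sup>2 * 2 ^ (m * CARD('n)) = (2 powr s) ^ m / 2 ^ (m * CARD('n))"
      by (simp add: power_mult_distrib power_divide power2_eq_square)
    also have "\<dots> = q ^ m"
      by (simp add: q_def powr_diff powr_realpow power_divide power_mult[symmetric] mult.commute)
    finally show "(\<Sum>a\<in>dyadic_indices (\<lambda>_::'n. m). (2 powr (s * m / 2) * (1 / 2 ^ (m * CARD('n))))\<^sup>2) = q ^ m"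
      by (simp add: card_dyadic_indices power_mult[symmetric] mult.commute)
  qed
  also have "\<dots> \<le> (\<Sum>m. q ^ m)" using q by (intro sum_le_suminf summable_geometric) auto
  finally show "dyadic_norm s L (indicator S) \<le> sqrt (\<Sum>m. q ^ m)"
    by (rule real_le_rsqrt)
qed

text \<open>Sets \<open>E n\<close> that carry densities \<open>g n\<close> converging to Lebesgue measure in the dyadic norm
  have intersections of positive \<open>s\<close>-dimensional measure, along a suitable subsequence. The
  measures with density \<open>f j\<close>, where \<open>f (j + 1)\<close> is \<open>f j\<close> times a late \<open>g n\<close>, move by as little
  as one wants in each step, so their masses stay away from \<open>0\<close> and their norms stay bounded.\<close>

lemma hausdorff_measure_intersection_pos:
  fixes E :: "nat \<Rightarrow> (real ^ 'n) set" and s :: real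
  assumes s: "0 < s" "s < CARD('n)"
    and g: "\<And>n. bounded_borel (g n)" "\<And>n x. 0 \<le> g n x" "\<And>n. \<exists>M. dyadic_step M (g n)"
    and supp: "\<And>n x. x \<in> unit_cube \<Longrightarrow> g n x \<noteq> 0 \<Longrightarrow> x \<in> E n"
    and closed: "\<And>n. closed (E n)"
    and norm: "\<And>n L. dyadic_norm s L (\<lambda>x. g n x - 1) \<le> \<delta> n" and \<delta>: "\<delta> \<longlonglongrightarrow> 0"
  obtains \<iota> :: "nat \<Rightarrow> nat" where "strict_mono \<iota>"
    "hausdorff_measure s (cbox (\<chi> i. 1/2) (\<chi> i. 1) \<inter> (\<Inter>j. E (\<iota> j))) \<noteq> 0"
proof -
  (* The construction starts from the uniform density on the upper corner cube of side 1/2. *)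
  define C0 where "C0 = dyadic_cube 1 (\<lambda>_::'n. 1)"
  define K0 where "K0 = (cbox (\<chi> i. 1/2) (\<chi> i. 1) :: (real ^ 'n) set)"
  have [measurable]: "C0 \<in> sets borel" by (simp add: C0_def)
  define c where "c = (1/2::real) ^ CARD('n)"
  have c: "0 < c" "c \<le> 1" by (auto simp: c_def power_le_one)
  obtain B0 where B0: "\<And>L. dyadic_norm s L (indicator C0 :: real ^ 'n \<Rightarrow> real) \<le> B0"
    using dyadic_norm_indicator_bounded[OF s(2), of C0] by auto
  (* Stage j may change mass and norm by c * (1/2)^(j+2); in total the mass never falls below c/2
     and the norm never exceeds B0 + 1. The component l is the index of the last density used. *)
  define P where "P j = (\<lambda>(f, K, l::nat). bounded_borel f \<and> (\<forall>x. 0 \<le> f x) \<and> (\<exists>M. dyadic_step M f) \<and>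
      (\<forall>x. f x \<noteq> 0 \<longrightarrow> x \<in> K \<and> x \<in> unit_cube) \<and> compact (K :: (real ^ 'n) set) \<and>
      c * (1/2 + (1/2) ^ Suc j) \<le> dyadic_mass f 0 (\<lambda>_. 0) \<and>
      (\<forall>L. dyadic_norm s L f \<le> B0 + (1 - (1/2) ^ j)))" for j :: nat
  define Q where "Q = (\<lambda>(f :: real ^ 'n \<Rightarrow> real, K, l) (f' :: real ^ 'n \<Rightarrow> real, K', l'). K' = K \<inter> E l' \<and> l < (l'::nat))"
  have "\<exists>F. \<forall>j. (P j (F j) \<and> (j = 0 \<longrightarrow> fst (snd (F j)) = K0)) \<and> Q (F j) (F (Suc j))"
  proof (rule dependent_nat_choice)
    have C0: "C0 \<subseteq> unit_cube" unfolding C0_def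
      by (rule dyadic_box_subset_unit_cube) (auto simp: dyadic_indices_def)
    have "x \<in> K0" if "x \<in> C0" for x
    proof -
      have "1/2 \<le> x $ i \<and> x $ i \<le> 1" for i
      proof -
        have "\<lfloor>2 * x $ i\<rfloor> = 1" using that by (auto simp: C0_def dyadic_box_def dyadic_index_def fun_eq_iff)
        then show ?thesis by linarith
      qed
      then show ?thesis by (simp add: K0_def mem_box_cart)
    qed
    moreover have "dyadic_mass (indicator C0) 0 (\<lambda>_. 0) = c"
    proof -
      have "dyadic_mass (indicator C0) 0 (\<lambda>_. 0) = measure lborel (unit_cube \<inter> C0)"
        by (simp add: dyadic_mass_def indicator_inter_arith[symmetric] unit_cube_conv_dyadic_cube)
      also have "unit_cube \<inter> C0 = C0" using C0 by blast
      finally show ?thesis by (simp add: C0_def measure_dyadic_box c_def)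
    qed
    moreover have "dyadic_step 1 (indicator C0)"
      by (auto simp: dyadic_step_def C0_def indicator_def mem_dyadic_box_iff)
    ultimately have "P 0 (indicator C0, K0, 0)"
      using C0 B0 by (auto simp: P_def K0_def intro: bounded_borel_indicator split: split_indicator_asm)
    then show "\<exists>x. P 0 x \<and> (0 = (0::nat) \<longrightarrow> fst (snd x) = K0)" by (intro exI) auto
  next
    fix x j assume "P j x \<and> (j = 0 \<longrightarrow> fst (snd x) = K0)"
    moreover obtain f K l where x: "x = (f, K, l)" by (cases x)
    ultimately have f: "bounded_borel f" "\<And>x. 0 \<le> f x" "\<exists>M. dyadic_step M f"
      "\<And>x. f x \<noteq> 0 \<Longrightarrow> x \<in> K \<and> x \<in> unit_cube" and K: "compact K"
      and mass: "c * (1/2 + (1/2) ^ Suc j) \<le> dyadic_mass f 0 (\<lambda>_. 0)"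
      and nrm: "\<And>L. dyadic_norm s L f \<le> B0 + (1 - (1/2) ^ j)"
      by (auto simp: P_def)
    obtain M where M: "dyadic_step M f" using f(3) by blast
    obtain C where C: "C \<ge> 0" "\<And>h \<delta> L. bounded_borel h \<Longrightarrow> (\<And>L. dyadic_norm s L h \<le> \<delta>) \<Longrightarrow>
        dyadic_norm s L (\<lambda>x. f x * h x) \<le> C * \<delta>"
      using dyadic_norm_step_times[OF s(1) M f(1)] by blast
    have "(\<lambda>n. C * \<delta> n) \<longlonglongrightarrow> C * 0" using \<delta> by (intro tendsto_intros)
    then have "\<forall>\<^sub>F n in sequentially. C * \<delta> n < c * (1/2) ^ (j + 2)"
      by (rule order_tendstoD) (use c in auto)
    then have "\<forall>\<^sub>F n in sequentially. l < n \<and> C * \<delta> n < c * (1/2) ^ (j + 2)"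
      using eventually_gt_at_top by (rule eventually_conj[rotated])
    then obtain n where n: "l < n" "C * \<delta> n < c * (1/2) ^ (j + 2)"
      by (metis (no_types, lifting) eventually_sequentially order_refl)
    define f' where "f' x = f x * g n x" for x
    define h where "h = (\<lambda>x. g n x - 1)"
    have h: "bounded_borel h" unfolding h_def by (intro bounded_borel_diff g bounded_borel_const)
    have fh: "dyadic_norm s L (\<lambda>x. f x * h x) \<le> c * (1/2) ^ (j + 2)" for L
    proof -
      have "dyadic_norm s L (\<lambda>x. f x * h x) \<le> C * \<delta> n"
        by (rule C(2)[OF h]) (simp only: h_def norm)
      then show ?thesis using n(2) by simp
    qed
    have fh_bb: "bounded_borel (\<lambda>x. f x * h x)" by (intro bounded_borel_mult f h)
    have f'_eq: "f' = (\<lambda>x. f x + f x * h x)" by (simp add: f'_def h_def fun_eq_iff algebra_simps)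
    have "P (Suc j) (f', K \<inter> E n, n)"
      unfolding P_def prod.case
    proof (intro conjI allI impI)
      show "bounded_borel f'" unfolding f'_def by (intro bounded_borel_mult f g)
      show "0 \<le> f' x" for x unfolding f'_def by (intro mult_nonneg_nonneg f g)
      obtain M' where M': "dyadic_step M' (g n)" using g(3) by blast
      show "\<exists>M. dyadic_step M f'"
      proof (intro exI[of _ "max M M'"], unfold dyadic_step_def, intro allI impI)
        fix x y :: "real ^ 'n" assume xy: "dyadic_index (\<lambda>_. max M M') x = dyadic_index (\<lambda>_. max M M') y"
        have "dyadic_index (\<lambda>_. M) x = dyadic_index (\<lambda>_. M) y" "dyadic_index (\<lambda>_. M') x = dyadic_index (\<lambda>_. M') y"
          by (rule dyadic_index_coarsen[OF _ xy]; simp)+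
        then have "f x = f y" "g n x = g n y" using M M' unfolding dyadic_step_def by blast+
        then show "f' x = f' y" by (simp add: f'_def)
      qed
      show "x \<in> K \<inter> E n" "x \<in> unit_cube" if "f' x \<noteq> 0" for x
        using that f(4)[of x] supp[of x n] by (auto simp: f'_def)
      show "compact (K \<inter> E n)" using K closed by (rule compact_Int_closed)
      have "\<bar>dyadic_mass (\<lambda>x. f x * h x) 0 (\<lambda>_. 0)\<bar> \<le> c * (1/2) ^ (j + 2)"
        by (rule order_trans[OF dyadic_mass_le_norm[OF s(1), of 0 1] fh]) (auto simp: dyadic_indices_def)
      moreover have "dyadic_mass f' 0 (\<lambda>_. 0) = dyadic_mass f 0 (\<lambda>_. 0) + dyadic_mass (\<lambda>x. f x * h x) 0 (\<lambda>_. 0)"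
        unfolding f'_eq by (rule dyadic_mass_add[OF f(1) fh_bb])
      ultimately show "c * (1/2 + (1/2) ^ Suc (Suc j)) \<le> dyadic_mass f' 0 (\<lambda>_. 0)"
        using mass by (simp add: algebra_simps)
      fix L
      have "dyadic_norm s L f' \<le> dyadic_norm s L f + dyadic_norm s L (\<lambda>x. f x * h x)"
        unfolding f'_eq by (rule dyadic_norm_triangle[OF f(1) fh_bb])
      moreover have "c * (1/2) ^ (j + 2) \<le> (1/2) ^ (j + 2)" using c by simp
      ultimately have "dyadic_norm s L f' \<le> B0 + (1 - (1/2) ^ j) + (1/2) ^ (j + 2)"
        using nrm[of L] fh[of L] by linarith
      then show "dyadic_norm s L f' \<le> B0 + (1 - (1/2) ^ Suc j)"
        by (rule order_trans) simp
    qed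
    then show "\<exists>y. (P (Suc j) y \<and> (Suc j = 0 \<longrightarrow> fst (snd y) = K0)) \<and> Q x y"
      using n(1) by (intro exI[of _ "(f', K \<inter> E n, n)"]) (auto simp: Q_def x)
  qed
  then obtain F where F: "\<And>j. P j (F j)" "fst (snd (F 0)) = K0" "\<And>j. Q (F j) (F (Suc j))" by blast
  define f where "f j = fst (F j)" for j
  define K where "K j = fst (snd (F j))" for j
  define l where "l j = snd (snd (F j))" for j
  have FP: "P j (f j, K j, l j)" for j using F(1)[of j] by (simp add: f_def K_def l_def)
  have FQ: "K (Suc j) = K j \<inter> E (l (Suc j))" "l j < l (Suc j)" for j
    using F(3)[of j] by (auto simp: Q_def f_def K_def l_def case_prod_unfold)
  have sm: "strict_mono (\<lambda>j. l (Suc j))" using FQ(2) by (simp add: strict_mono_Suc_iff)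
  have props: "bounded_borel (f j)" "0 \<le> f j x" "f j x \<noteq> 0 \<Longrightarrow> x \<in> K j \<and> x \<in> unit_cube" "compact (K j)"
    "c * (1/2 + (1/2) ^ Suc j) \<le> dyadic_mass (f j) 0 (\<lambda>_. 0)" "dyadic_norm s L (f j) \<le> B0 + (1 - (1/2) ^ j)" for j x L
    using FP[of j] unfolding P_def by auto
  have "hausdorff_measure s (\<Inter>j. K j) \<noteq> 0"
  proof (rule hausdorff_measure_pos_of_dyadic_norm[OF s(1), of "c/2" K f "B0 + 1"])
    fix j
    have supp_j: "f j x \<noteq> 0 \<Longrightarrow> x \<in> unit_cube" for x using props(3) by blast
    show "integrable lborel (f j)" by (rule integrable_on_unit_cube(1)[OF props(1) supp_j])
    have "c / 2 \<le> c * (1/2 + (1/2) ^ Suc j)" using c by (simp add: distrib_left)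
    also have "\<dots> \<le> dyadic_mass (f j) 0 (\<lambda>_. 0)" by (rule props)
    also have "\<dots> = (\<integral>x. f j x \<partial>lborel)"
      by (rule integrable_on_unit_cube(2)[OF props(1) supp_j, symmetric])
    finally show "c / 2 \<le> (\<integral>x. f j x \<partial>lborel)" .
    show "dyadic_norm s L (f j) \<le> B0 + 1" for L
      using props(6)[where j=j and L=L] zero_le_power[of "1/2::real" j] by linarith
  qed (use c props FQ in auto)
  moreover have "(\<Inter>j. K j) \<subseteq> K0 \<inter> (\<Inter>j. E (l (Suc j)))"
  proof
    fix x assume x: "x \<in> (\<Inter>j. K j)"
    have "x \<in> K 0" "\<And>j. x \<in> K (Suc j)" using x by auto
    then show "x \<in> K0 \<inter> (\<Inter>j. E (l (Suc j)))" using F(2) FQ(1) by (auto simp: K_def)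
  qed
  ultimately have "hausdorff_measure s (K0 \<inter> (\<Inter>j. E (l (Suc j)))) \<noteq> 0"
    using hausdorff_measure_null_subset by blast
  then show thesis using that[OF sm] by (simp add: K0_def)
qed

section \<open>Random dyadic boxes\<close>

definition frac_vec :: "real ^ 'n \<Rightarrow> real ^ 'n" where
  "frac_vec y = (\<chi> i. frac (y $ i))"

lemma frac_vec_eq_self: "y \<in> unit_cube \<Longrightarrow> frac_vec y = y"
  by (simp add: frac_vec_def unit_cube_def vec_eq_iff frac_eq)

lemma frac_vec_add_int_vector: "int_vector z \<Longrightarrow> frac_vec (y + z) = frac_vec y"
proof -
  assume "int_vector z"
  then have "frac (y $ i + z $ i) = frac (y $ i)" for i
    by (auto simp: int_vector_def frac_def elim!: Ints_cases dest!: spec[of _ i])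
  then show ?thesis by (simp add: frac_vec_def)
qed

text \<open>The dyadic box that contains the class of \<open>y\<close> modulo \<open>1\<close>. Unlike a box centred at \<open>y\<close> it never wraps
  around the torus, and its nonempty intersections with dyadic cubes are dyadic boxes again.\<close>

definition torus_box :: "('n \<Rightarrow> nat) \<Rightarrow> real ^ 'n \<Rightarrow> (real ^ 'n) set" where
  "torus_box p y = dyadic_box p (dyadic_index p (frac_vec y))"

text \<open>The mass that the uniform distribution on \<open>torus_box p y\<close> assigns to a dyadic cube.\<close>

definition box_share :: "('n \<Rightarrow> nat) \<Rightarrow> nat \<Rightarrow> ('n \<Rightarrow> int) \<Rightarrow> real ^ 'n \<Rightarrow> real" where
  "box_share p m b y = (\<Prod>i\<in>UNIV. 2 ^ p i) * measure lborel (dyadic_cube m b \<inter> torus_box p y)"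

definition overlap_bound :: "('n \<Rightarrow> nat) \<Rightarrow> nat \<Rightarrow> real" where
  "overlap_bound p m = (\<Prod>i\<in>UNIV. 2 ^ p i / 2 ^ max m (p i))"

lemma box_share_nonneg: "0 \<le> box_share p m b y"
  by (simp add: box_share_def prod_nonneg)

text \<open>A nonempty intersection of two dyadic boxes is the dyadic box that has in each direction the
  finer of the two levels.\<close>

lemma box_share_le: "box_share p m b y \<le> overlap_bound p m"
proof -
  have "measure lborel (dyadic_cube m b \<inter> torus_box p y) \<le> (\<Prod>i\<in>UNIV. 1 / 2 ^ max m (p i))"
  proof (cases "dyadic_cube m b \<inter> torus_box p y = {}")
    case False
    then obtain z where z: "z \<in> dyadic_cube m b" "z \<in> torus_box p y" by blast
    have "dyadic_cube m b \<inter> torus_box p y \<subseteq> dyadic_box (\<lambda>i. max m (p i)) (dyadic_index (\<lambda>i. max m (p i)) z)"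
    proof
      fix x assume x: "x \<in> dyadic_cube m b \<inter> torus_box p y"
      have "dyadic_index (\<lambda>_. m) x = dyadic_index (\<lambda>_. m) z" "dyadic_index p x = dyadic_index p z"
        using x z by (auto simp: mem_dyadic_box_iff torus_box_def)
      then have "dyadic_index (\<lambda>i. max m (p i)) x = dyadic_index (\<lambda>i. max m (p i)) z"
        by (auto simp: dyadic_index_def fun_eq_iff max_def)
      then show "x \<in> dyadic_box (\<lambda>i. max m (p i)) (dyadic_index (\<lambda>i. max m (p i)) z)"
        by (simp add: mem_dyadic_box_iff)
    qed
    then have "measure lborel (dyadic_cube m b \<inter> torus_box p y)
        \<le> measure lborel (dyadic_box (\<lambda>i. max m (p i)) (dyadic_index (\<lambda>i. max m (p i)) z))"
      by (intro measure_mono_fmeasurable) (auto simp: fmeasurable_def emeasure_dyadic_box torus_box_def)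
    then show ?thesis by (simp add: measure_dyadic_box)
  qed (simp add: prod_nonneg)
  then have "box_share p m b y \<le> (\<Prod>i\<in>UNIV. 2 ^ p i) * (\<Prod>i\<in>UNIV. 1 / 2 ^ max m (p i))"
    unfolding box_share_def by (intro mult_left_mono) (auto simp: prod_nonneg)
  then show ?thesis by (simp add: overlap_bound_def flip: prod.distrib)
qed

lemma box_share_measurable [measurable]: "box_share p m b \<in> borel_measurable borel"
proof -
  have "(\<lambda>y. dyadic_index p (frac_vec y)) \<in> measurable borel (count_space UNIV)"
  proof (subst measurable_count_space_eq2_countable, safe)
    fix a
    have "(\<lambda>y. dyadic_index p (frac_vec y)) -` {a} \<inter> space borel
        = {y \<in> space borel. \<forall>i. \<lfloor>2 ^ p i * (y $ i - of_int \<lfloor>y $ i\<rfloor>)\<rfloor> = a i}"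
      by (auto simp: dyadic_index_def frac_vec_def frac_def fun_eq_iff)
    also have "\<dots> \<in> sets borel" by measurable
    finally show "(\<lambda>y. dyadic_index p (frac_vec y)) -` {a} \<inter> space borel \<in> sets borel" .
  qed auto
  from measurable_compose[OF this, of "\<lambda>a. (\<Prod>i\<in>UNIV. 2 ^ p i) * measure lborel (dyadic_cube m b \<inter> dyadic_box p a)" borel]
  show ?thesis by (simp add: box_share_def[abs_def] torus_box_def)
qed

lemma box_share_periodic: "unit_periodic (box_share p m b)"
  by (simp add: unit_periodic_def box_share_def torus_box_def frac_vec_add_int_vector)

text \<open>The boxes of shape \<open>p\<close> partition the unit cube, and spreading the mass of a uniform point evenly over
  its box does not change the uniform distribution. So the expected share of a cube is its volume.\<close>

lemma nn_integral_box_share: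
  fixes b :: "'n::finite \<Rightarrow> int"
  assumes b: "b \<in> dyadic_indices (\<lambda>_. m)"
  shows "(\<integral>\<^sup>+y. ennreal (box_share p m b y) \<partial>cube_measure) = ennreal (1 / 2 ^ (m * CARD('n)))"
proof -
  define V where "V = (\<Prod>i\<in>UNIV. 2 ^ p i :: real)"
  have V: "V > 0" by (simp add: V_def prod_pos)
  define \<mu> where "\<mu> a = measure lborel (dyadic_cube m b \<inter> dyadic_box p a)" for a
  have vol: "emeasure lborel (dyadic_box p a) = ennreal (1 / V)" for a :: "'n \<Rightarrow> int"
    by (simp add: emeasure_dyadic_box V_def prod_dividef)
  have fin: "emeasure lborel (dyadic_cube m b \<inter> dyadic_box p a) = ennreal (\<mu> a)" for a
    unfolding \<mu>_def
    by (rule emeasure_eq_ennreal_measure)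
       (metis emeasure_dyadic_box emeasure_mono inf_le1 dyadic_box_borel sets_lborel ennreal_neq_top top.extremum_unique)
  have pt: "ennreal (box_share p m b y) * indicator unit_cube y
      = (\<Sum>a\<in>dyadic_indices p. ennreal (V * \<mu> a) * indicator (dyadic_box p a) y)" for y
  proof (cases "y \<in> unit_cube")
    case True
    have "(\<Sum>a\<in>dyadic_indices p. ennreal (V * \<mu> a) * indicator (dyadic_box p a) y)
        = (\<Sum>a\<in>dyadic_indices p. if a = dyadic_index p y then ennreal (V * \<mu> a) else 0)"
      by (intro sum.cong) (auto simp: indicator_def mem_dyadic_box_iff)
    also have "\<dots> = ennreal (V * \<mu> (dyadic_index p y))"
      using True by (simp add: dyadic_index_mem_iff)
    finally show ?thesis using True by (simp add: box_share_def torus_box_def frac_vec_eq_self V_def \<mu>_def)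
  next
    case False
    then have "y \<notin> dyadic_box p a" if "a \<in> dyadic_indices p" for a
      using dyadic_box_subset_unit_cube[OF that] by blast
    then have "(\<Sum>a\<in>dyadic_indices p. ennreal (V * \<mu> a) * indicator (dyadic_box p a) y) = 0"
      by (intro sum.neutral ballI) simp
    with False show ?thesis by simp
  qed
  have "(\<integral>\<^sup>+y. ennreal (box_share p m b y) \<partial>cube_measure)
      = (\<integral>\<^sup>+y. (\<Sum>a\<in>dyadic_indices p. ennreal (V * \<mu> a) * indicator (dyadic_box p a) y) \<partial>lborel)"
    by (simp add: nn_integral_cube_measure pt)
  also have "\<dots> = (\<Sum>a\<in>dyadic_indices p. ennreal (V * \<mu> a) * emeasure lborel (dyadic_box p a))"
    by (subst nn_integral_sum) (auto simp: nn_integral_cmult_indicator)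
  also have "\<dots> = (\<Sum>a\<in>dyadic_indices p. emeasure lborel (dyadic_cube m b \<inter> dyadic_box p a))"
    using V by (intro sum.cong refl) (simp add: vol fin ennreal_mult[symmetric] \<mu>_def)
  also have "\<dots> = emeasure lborel (\<Union>a\<in>dyadic_indices p. dyadic_cube m b \<inter> dyadic_box p a)"
    by (rule sum_emeasure) (auto simp: disjoint_family_on_def mem_dyadic_box_iff)
  also have "(\<Union>a\<in>dyadic_indices p. dyadic_cube m b \<inter> dyadic_box p a) = dyadic_cube m b"
  proof -
    have "x \<in> (\<Union>a\<in>dyadic_indices p. dyadic_cube m b \<inter> dyadic_box p a)" if "x \<in> dyadic_cube m b" for x
      using that dyadic_box_subset_unit_cube[OF b] by (auto simp: mem_dyadic_box_iff[of x p] dyadic_index_mem_iff)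
    then show ?thesis by blast
  qed
  also have "emeasure lborel (dyadic_cube m b) = ennreal (1 / 2 ^ (m * CARD('n)))"
    by (simp add: emeasure_dyadic_box power_divide power_mult)
  finally show ?thesis .
qed

text \<open>Pairwise uncorrelated variables suffice for the variance of an average to decay like the
  reciprocal of the number of terms. The result is stated for \<open>nn_integral\<close>, so that it can be summed
  over infinitely many averages without regard to convergence.\<close>

lemma second_moment_of_average:
  fixes X :: "'k \<Rightarrow> 'a \<Rightarrow> real"
  assumes M: "finite_measure M" "measure M (space M) = 1"
    and S: "finite S" "S \<noteq> {}"
    and meas [measurable]: "\<And>k. k \<in> S \<Longrightarrow> X k \<in> borel_measurable M"
    and bdd: "\<And>k x. k \<in> S \<Longrightarrow> \<bar>X k x\<bar> \<le> B"
    and mean: "\<And>k. k \<in> S \<Longrightarrow> (\<integral>x. X k x \<partial>M) = q"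
    and indep: "\<And>k l. k \<in> S \<Longrightarrow> l \<in> S \<Longrightarrow> k \<noteq> l \<Longrightarrow> (\<integral>x. X k x * X l x \<partial>M) = q\<^sup>2"
    and second: "\<And>k. k \<in> S \<Longrightarrow> (\<integral>x. X k x * X k x \<partial>M) \<le> w"
  shows "(\<integral>\<^sup>+x. ennreal (((\<Sum>k\<in>S. X k x) / card S - q)\<^sup>2) \<partial>M) \<le> ennreal (w / card S)"
proof -
  interpret finite_measure M by (rule M(1))
  define N where "N = real (card S)"
  have N: "N > 0" using S by (simp add: N_def card_gt_0_iff)
  have B0: "B \<ge> 0" using S(2) bdd by (meson abs_ge_zero ex_in_conv order_trans)
  have int1: "integrable M (X k)" if "k \<in> S" for k
    by (rule integrable_const_bound[of _ B]) (use that bdd in auto)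
  have int2: "integrable M (\<lambda>x. X k x * X l x)" if "k \<in> S" "l \<in> S" for k l
  proof (rule integrable_const_bound[of _ "B * B"])
    show "AE x in M. norm (X k x * X l x) \<le> B * B"
      using bdd that B0 by (auto simp: abs_mult intro!: mult_mono)
  qed (use that in auto)
  define Y where "Y x = (\<Sum>k\<in>S. \<Sum>l\<in>S. X k x * X l x) / N\<^sup>2 - 2 * q * ((\<Sum>k\<in>S. X k x) / N) + q\<^sup>2" for x
  have Y: "((\<Sum>k\<in>S. X k x) / N - q)\<^sup>2 = Y x" for x
    by (simp add: Y_def power2_diff power_divide sum_product power2_eq_square[of "\<Sum>k\<in>S. X k x"] mult_ac)
  have intsum: "integrable M (\<lambda>x. \<Sum>k\<in>S. \<Sum>l\<in>S. X k x * X l x)" "integrable M (\<lambda>x. \<Sum>k\<in>S. X k x)"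
    using int1 int2 by (auto intro!: Bochner_Integration.integrable_sum)
  then have intY: "integrable M Y"
    unfolding Y_def by (intro Bochner_Integration.integrable_add Bochner_Integration.integrable_diff
        integrable_divide integrable_mult_right) auto
  have sum1: "(\<integral>x. (\<Sum>k\<in>S. X k x) \<partial>M) = N * q"
    using int1 mean by (subst Bochner_Integration.integral_sum) (auto simp: N_def)
  have "(\<integral>x. (\<Sum>k\<in>S. \<Sum>l\<in>S. X k x * X l x) \<partial>M) = (\<Sum>k\<in>S. \<Sum>l\<in>S. \<integral>x. X k x * X l x \<partial>M)"
    using int2 by (subst Bochner_Integration.integral_sum)
      (auto intro!: sum.cong Bochner_Integration.integrable_sum Bochner_Integration.integral_sum)
  also have "\<dots> \<le> (\<Sum>k\<in>S. \<Sum>l\<in>S. q\<^sup>2 + (if l = k then w else 0))"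
    using indep second by (intro sum_mono) (auto intro: add_increasing)
  also have "\<dots> = N\<^sup>2 * q\<^sup>2 + N * w"
    using S(1) by (simp add: sum.distrib N_def power2_eq_square algebra_simps)
  finally have sum2: "(\<integral>x. (\<Sum>k\<in>S. \<Sum>l\<in>S. X k x * X l x) \<partial>M) \<le> N\<^sup>2 * q\<^sup>2 + N * w" .
  have "(\<integral>x. Y x \<partial>M) = (\<integral>x. (\<Sum>k\<in>S. \<Sum>l\<in>S. X k x * X l x) \<partial>M) / N\<^sup>2 - 2 * q * ((N * q) / N) + q\<^sup>2"
    unfolding Y_def sum1[symmetric] using intsum M(2) by simp
  also have "\<dots> \<le> (N\<^sup>2 * q\<^sup>2 + N * w) / N\<^sup>2 - 2 * q * ((N * q) / N) + q\<^sup>2"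
    using sum2 N by (intro add_mono diff_mono divide_right_mono) auto
  also have "\<dots> = w / N" using N by (simp add: field_simps power2_eq_square)
  finally have "(\<integral>x. Y x \<partial>M) \<le> w / N" .
  moreover have "(\<integral>\<^sup>+x. ennreal (Y x) \<partial>M) = ennreal (\<integral>x. Y x \<partial>M)"
    by (rule nn_integral_eq_integral[OF intY]) (simp add: Y[symmetric])
  ultimately show ?thesis unfolding N_def[symmetric] Y by (simp add: ennreal_leI)
qed

definition orbit :: "(nat \<Rightarrow> int ^ 'n ^ 'n) \<Rightarrow> nat \<Rightarrow> (real ^ 'n) \<times> (real ^ 'n) \<Rightarrow> real ^ 'n" where
  "orbit A k = (\<lambda>(\<alpha>, x). x + int_mat_apply (A k) \<alpha>)"

abbreviation pair_measure_cube :: "((real ^ 'n) \<times> (real ^ 'n)) measure" where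
  "pair_measure_cube \<equiv> cube_measure \<Otimes>\<^sub>M cube_measure"

lemma orbit_measurable [measurable]: "orbit A k \<in> borel_measurable pair_measure_cube"
  unfolding orbit_def by measurable

lemma finite_measure_pair_cube:
  shows "finite_measure pair_measure_cube"
  "measure pair_measure_cube (space pair_measure_cube) = 1"
proof -
  interpret C: finite_measure "cube_measure :: (real ^ 'n) measure" by (rule finite_measure_cube_measure)
  have "emeasure pair_measure_cube (unit_cube \<times> unit_cube) = 1"
    by (subst C.emeasure_pair_measure_Times) (auto simp: emeasure_cube_measure_space sets_cube_measure)
  then have e: "emeasure pair_measure_cube (space pair_measure_cube) = 1"
    by (simp add: space_pair_measure)
  show "finite_measure pair_measure_cube" by (rule finite_measureI) (simp add: e)
  show "measure pair_measure_cube (space pair_measure_cube) = 1" by (simp add: measure_def e)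
qed

lemma nn_integral_pair_cube:
  fixes f :: "(real ^ 'n) \<times> (real ^ 'n) \<Rightarrow> ennreal"
  assumes "f \<in> borel_measurable pair_measure_cube"
  shows "(\<integral>\<^sup>+\<omega>. f \<omega> \<partial>pair_measure_cube) = (\<integral>\<^sup>+\<alpha>. \<integral>\<^sup>+x. f (\<alpha>, x) \<partial>cube_measure \<partial>cube_measure)"
proof -
  interpret C: finite_measure "cube_measure :: (real ^ 'n) measure" by (rule finite_measure_cube_measure)
  show ?thesis by (rule C.nn_integral_fst[symmetric]) (rule assms)
qed

lemma nn_integral_orbit:
  fixes A :: "nat \<Rightarrow> int ^ 'n ^ 'n"
  assumes [measurable]: "H \<in> borel_measurable borel" and per: "unit_periodic H"
  shows "(\<integral>\<^sup>+\<omega>. H (orbit A k \<omega>) \<partial>pair_measure_cube) = (\<integral>\<^sup>+x. H x \<partial>cube_measure)"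
proof -
  have "(\<integral>\<^sup>+\<omega>. H (orbit A k \<omega>) \<partial>pair_measure_cube)
      = (\<integral>\<^sup>+\<alpha>. \<integral>\<^sup>+x. H (x + int_mat_apply (A k) \<alpha>) \<partial>cube_measure \<partial>(cube_measure :: (real ^ 'n) measure))"
    by (subst nn_integral_pair_cube) (auto simp: orbit_def[abs_def] case_prod_unfold)
  also have "\<dots> = (\<integral>\<^sup>+\<alpha>. \<integral>\<^sup>+x. H x \<partial>cube_measure \<partial>(cube_measure :: (real ^ 'n) measure))"
    by (simp add: nn_integral_cube_shift[OF _ per])
  finally show ?thesis by (simp add: emeasure_cube_measure_space)
qed

lemma nn_integral_orbit_pair:
  fixes A :: "nat \<Rightarrow> int ^ 'n ^ 'n"
  assumes [measurable]: "H \<in> borel_measurable borel" "G \<in> borel_measurable borel"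
    and per: "unit_periodic H" "unit_periodic G" and det: "det (A l - A k) \<noteq> 0"
  shows "(\<integral>\<^sup>+\<omega>. H (orbit A k \<omega>) * G (orbit A l \<omega>) \<partial>pair_measure_cube)
    = (\<integral>\<^sup>+x. H x \<partial>cube_measure) * (\<integral>\<^sup>+x. G x \<partial>cube_measure)"
proof -
  have "(\<integral>\<^sup>+\<omega>. H (orbit A k \<omega>) * G (orbit A l \<omega>) \<partial>pair_measure_cube)
      = (\<integral>\<^sup>+\<alpha>. \<integral>\<^sup>+x. H (x + int_mat_apply (A k) \<alpha>) * G (x + int_mat_apply (A l) \<alpha>) \<partial>cube_measure \<partial>cube_measure)"
    by (subst nn_integral_pair_cube) (auto simp: orbit_def[abs_def] case_prod_unfold)
  also have "\<dots> = (\<integral>\<^sup>+x. H x \<partial>cube_measure) * (\<integral>\<^sup>+x. G x \<partial>cube_measure)"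
    by (rule nn_integral_cube_independent) (use det per in auto)
  finally show ?thesis .
qed

definition discrepancy :: "(nat \<Rightarrow> int ^ 'n ^ 'n) \<Rightarrow> ('n \<Rightarrow> nat) \<Rightarrow> nat set \<Rightarrow> nat \<Rightarrow> ('n \<Rightarrow> int) \<Rightarrow> (real ^ 'n) \<times> (real ^ 'n) \<Rightarrow> real" where
  "discrepancy A p S m b \<omega> = (\<Sum>k\<in>S. box_share p m b (orbit A k \<omega>)) / card S - 1 / 2 ^ (m * CARD('n))"

lemma discrepancy_measurable [measurable]: "discrepancy A p S m b \<in> borel_measurable pair_measure_cube"
  unfolding discrepancy_def by measurable

text \<open>The shares of different points are independent, so only their individual second moments matter, and
  each of these is at most the maximum of a share times its mean.\<close>

lemma nn_integral_discrepancy: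
  fixes A :: "nat \<Rightarrow> int ^ 'n ^ 'n"
  assumes b: "b \<in> dyadic_indices (\<lambda>_. m)" and S: "finite S" "S \<noteq> {}"
    and det: "\<And>k l. k \<in> S \<Longrightarrow> l \<in> S \<Longrightarrow> k \<noteq> l \<Longrightarrow> det (A k - A l) \<noteq> 0"
  shows "(\<integral>\<^sup>+\<omega>. ennreal ((discrepancy A p S m b \<omega>)\<^sup>2) \<partial>pair_measure_cube)
    \<le> ennreal (overlap_bound p m / 2 ^ (m * CARD('n)) / card S)"
  unfolding discrepancy_def
proof (rule second_moment_of_average[OF finite_measure_pair_cube S(1,2)])
  define q :: real where "q = 1 / 2 ^ (m * CARD('n))"
  define h where "h = box_share p m b"
  have q0: "q \<ge> 0" by (simp add: q_def)
  have h: "0 \<le> h y" "h y \<le> overlap_bound p m" for y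
    by (auto simp: h_def box_share_nonneg box_share_le)
  have D0: "0 \<le> overlap_bound p m" using h order_trans by blast
  have hm [measurable]: "h \<in> borel_measurable borel" by (simp add: h_def)
  have hper: "unit_periodic (\<lambda>y. ennreal (h y))"
    using box_share_periodic[of p m b] by (simp add: unit_periodic_def h_def)
  have hint: "(\<integral>\<^sup>+y. ennreal (h y) \<partial>cube_measure) = ennreal q"
    unfolding h_def q_def by (rule nn_integral_box_share[OF b])
  fix k assume k: "k \<in> S"
  show "(\<lambda>\<omega>. box_share p m b (orbit A k \<omega>)) \<in> borel_measurable pair_measure_cube" by measurable
  show "\<bar>box_share p m b (orbit A k \<omega>)\<bar> \<le> overlap_bound p m" for \<omega>
    by (simp add: box_share_nonneg box_share_le)
  have mean: "(\<integral>\<^sup>+\<omega>. ennreal (h (orbit A k \<omega>)) \<partial>pair_measure_cube) = ennreal q"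
    using nn_integral_orbit[OF _ hper, of A k] hint by simp
  then show "(\<integral>\<omega>. box_share p m b (orbit A k \<omega>) \<partial>pair_measure_cube) = 1 / 2 ^ (m * CARD('n))"
    unfolding h_def[symmetric] q_def[symmetric]
    by (subst integral_eq_nn_integral) (auto simp: h q0)
  show "(\<integral>\<omega>. box_share p m b (orbit A k \<omega>) * box_share p m b (orbit A l \<omega>) \<partial>pair_measure_cube)
      = (1 / 2 ^ (m * CARD('n)))\<^sup>2" if l: "l \<in> S" "k \<noteq> l" for l
  proof -
    have "(\<integral>\<^sup>+\<omega>. ennreal (h (orbit A k \<omega>) * h (orbit A l \<omega>)) \<partial>pair_measure_cube) = ennreal q * ennreal q"
      using nn_integral_orbit_pair[OF _ _ hper hper, of A l k] det[of l k] k l hint by (simp add: ennreal_mult h)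
    then show ?thesis
      unfolding h_def[symmetric] q_def[symmetric]
      by (subst integral_eq_nn_integral) (auto simp: h q0 power2_eq_square simp flip: ennreal_mult)
  qed
  have "(\<integral>\<^sup>+\<omega>. ennreal (h (orbit A k \<omega>) * h (orbit A k \<omega>)) \<partial>pair_measure_cube)
      \<le> (\<integral>\<^sup>+\<omega>. ennreal (overlap_bound p m) * ennreal (h (orbit A k \<omega>)) \<partial>pair_measure_cube)"
    by (intro nn_integral_mono) (auto simp: D0 h mult_right_mono simp flip: ennreal_mult intro!: ennreal_leI)
  also have "\<dots> = ennreal (overlap_bound p m * q)"
    using mean by (simp add: nn_integral_cmult ennreal_mult D0 q0)
  finally show "(\<integral>\<omega>. box_share p m b (orbit A k \<omega>) * box_share p m b (orbit A k \<omega>) \<partial>pair_measure_cube)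
      \<le> overlap_bound p m / 2 ^ (m * CARD('n))"
    unfolding h_def[symmetric]
    by (subst integral_eq_nn_integral) (auto simp: h D0 q_def intro: enn2real_leI)
qed

section \<open>The exponent\<close>

text \<open>A box with sides \<open>R powr (- \<tau> j)\<close> has a proportion of about \<open>R powr (- excess \<tau> u)\<close> of its volume
  in common with a cube of side \<open>R powr (- u)\<close> around one of its points.\<close>

definition excess :: "('n::finite \<Rightarrow> real) \<Rightarrow> real \<Rightarrow> real" where
  "excess \<tau> u = (\<Sum>j\<in>UNIV. max 0 (u - \<tau> j))"

definition critical_exponent :: "('n::finite \<Rightarrow> real) \<Rightarrow> real" where
  "critical_exponent \<tau> = (MIN i\<in>UNIV. (1 + (\<Sum>j | \<tau> j < \<tau> i. \<tau> i - \<tau> j)) / \<tau> i)"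

lemma excess_eq: "(\<Sum>j | \<tau> j < u. u - \<tau> j) = excess \<tau> u"
proof -
  have "excess \<tau> u = (\<Sum>j\<in>UNIV. if \<tau> j < u then u - \<tau> j else 0)"
    unfolding excess_def by (intro sum.cong) auto
  then show ?thesis by (simp add: sum.If_cases)
qed

lemma excess_nonneg: "0 \<le> excess \<tau> u"
  unfolding excess_def by (intro sum_nonneg) auto

text \<open>The least levels for which dyadic boxes have sides of at most \<open>k powr (- \<tau> i)\<close> for all
  \<open>k \<le> 2\<^sup>n\<^sup>+\<^sup>1\<close>, the upper end of the \<open>n\<close>-th block.\<close>

definition level :: "('n \<Rightarrow> real) \<Rightarrow> nat \<Rightarrow> 'n \<Rightarrow> nat" where
  "level \<tau> n i = nat \<lceil>\<tau> i * (n + 1)\<rceil>"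

context
  fixes \<tau> :: "'n::finite \<Rightarrow> real"
  assumes \<tau>: "\<And>i. 0 < \<tau> i"
begin

lemma critical_exponent_le: "critical_exponent \<tau> \<le> (1 + excess \<tau> (\<tau> i)) / \<tau> i"
  unfolding critical_exponent_def excess_eq by (intro Min_le) auto

lemma critical_exponent_attained: "\<exists>i. critical_exponent \<tau> = (1 + excess \<tau> (\<tau> i)) / \<tau> i"
proof -
  have "critical_exponent \<tau> \<in> range (\<lambda>i. (1 + excess \<tau> (\<tau> i)) / \<tau> i)"
    unfolding critical_exponent_def excess_eq by (intro Min_in) auto
  then show ?thesis by auto
qed

lemma critical_exponent_pos: "0 < critical_exponent \<tau>"
proof -
  obtain i where "critical_exponent \<tau> = (1 + excess \<tau> (\<tau> i)) / \<tau> i" using critical_exponent_attained by blast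
  moreover have "0 < 1 + excess \<tau> (\<tau> i)" using excess_nonneg[of \<tau> "\<tau> i"] by linarith
  ultimately show ?thesis using \<tau>[of i] by simp
qed

lemma critical_exponent_less_dim:
  assumes "(\<Sum>i\<in>UNIV. \<tau> i) > 1"
  shows "critical_exponent \<tau> < real CARD('n)"
proof -
  have "Max (range \<tau>) \<in> range \<tau>" by (intro Max_in) auto
  then obtain i where i: "\<tau> i = Max (range \<tau>)" by (metis rangeE)
  have "\<tau> j \<le> \<tau> i" for j unfolding i by (intro Max_ge) auto
  then have "excess \<tau> (\<tau> i) = (\<Sum>j\<in>UNIV. \<tau> i - \<tau> j)"
    unfolding excess_def by (intro sum.cong) auto
  also have "\<dots> = real CARD('n) * \<tau> i - (\<Sum>j\<in>UNIV. \<tau> j)" by (simp add: sum_subtractf)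
  finally have "(1 + excess \<tau> (\<tau> i)) / \<tau> i < real CARD('n)"
    using assms \<tau>[of i] by (simp add: divide_less_eq)
  then show ?thesis using critical_exponent_le[of i] by linarith
qed

text \<open>As a function of \<open>u\<close> the left-hand side is concave and piecewise linear with breakpoints \<open>\<tau> i\<close>. Its
  slope is positive to the left of all breakpoints and, as the exponent is less than the dimension,
  negative to the right of them. Hence the maximum is attained at some \<open>\<tau> i\<close>, where the bound
  follows from the definition of the critical exponent. The proof moves from \<open>u\<close> to a neighbouring
  breakpoint, in the direction given by the sign of the slope at \<open>u\<close>.\<close>

lemma critical_exponent_mult_le:
  assumes "(\<Sum>i\<in>UNIV. \<tau> i) > 1"
  shows "critical_exponent \<tau> * u - excess \<tau> u \<le> 1"
proof -
  define s where "s = critical_exponent \<tau>"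
  define S where "S = {j. \<tau> j < u}"
  have lin: "excess \<tau> v = real (card S) * v - (\<Sum>j\<in>S. \<tau> j)"
    if "\<And>j. j \<in> S \<Longrightarrow> \<tau> j \<le> v" "\<And>j. j \<notin> S \<Longrightarrow> v \<le> \<tau> j" for v
  proof -
    have "excess \<tau> v = (\<Sum>j\<in>UNIV. if j \<in> S then v - \<tau> j else 0)"
      unfolding excess_def using that by (intro sum.cong) auto
    then show ?thesis by (simp add: sum.If_cases sum_subtractf)
  qed
  have u: "excess \<tau> u = real (card S) * u - (\<Sum>j\<in>S. \<tau> j)"
    by (rule lin) (auto simp: S_def)
  have at_\<tau>: "s * \<tau> i - excess \<tau> (\<tau> i) \<le> 1" for i
    using critical_exponent_le[of i] \<tau>[of i] by (simp add: s_def pos_le_divide_eq)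
  have "\<exists>i. excess \<tau> (\<tau> i) = real (card S) * \<tau> i - (\<Sum>j\<in>S. \<tau> j) \<and> (s - card S) * u \<le> (s - card S) * \<tau> i"
  proof (cases "real (card S) \<le> s")
    case True
    have "S \<noteq> UNIV" using True critical_exponent_less_dim[OF assms] by (auto simp: s_def)
    then have "Min (\<tau> ` (-S)) \<in> \<tau> ` (-S)" by (intro Min_in) auto
    then obtain i where i: "i \<notin> S" "\<tau> i = Min (\<tau> ` (-S))" by (metis ComplD imageE)
    have min: "\<tau> i \<le> \<tau> j" if "j \<notin> S" for j unfolding i(2) using that by (intro Min_le) auto
    have "u \<le> \<tau> i" using i(1) by (simp add: S_def)
    moreover have "excess \<tau> (\<tau> i) = real (card S) * \<tau> i - (\<Sum>j\<in>S. \<tau> j)"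
      using min \<open>u \<le> \<tau> i\<close> by (intro lin) (auto simp: S_def)
    ultimately show ?thesis using True by (intro exI[of _ i] conjI mult_left_mono) auto
  next
    case False
    then have "S \<noteq> {}" using critical_exponent_pos by (auto simp: s_def)
    then have "Max (\<tau> ` S) \<in> \<tau> ` S" by (intro Max_in) auto
    then obtain i where i: "i \<in> S" "\<tau> i = Max (\<tau> ` S)" by (metis imageE)
    have max: "\<tau> j \<le> \<tau> i" if "j \<in> S" for j unfolding i(2) using that by (intro Max_ge) auto
    have "\<tau> i < u" using i(1) by (simp add: S_def)
    moreover have "excess \<tau> (\<tau> i) = real (card S) * \<tau> i - (\<Sum>j\<in>S. \<tau> j)"
      using max \<open>\<tau> i < u\<close> by (intro lin) (auto simp: S_def)
    ultimately show ?thesis using False by (intro exI[of _ i] conjI mult_left_mono_neg) auto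
  qed
  then obtain i where i: "excess \<tau> (\<tau> i) = real (card S) * \<tau> i - (\<Sum>j\<in>S. \<tau> j)"
    "(s - card S) * u \<le> (s - card S) * \<tau> i" by blast
  then have "s * u - excess \<tau> u \<le> s * \<tau> i - excess \<tau> (\<tau> i)" by (simp add: u algebra_simps)
  then show ?thesis using at_\<tau>[of i] by (simp add: s_def)
qed

text \<open>This is \<open>critical_exponent_mult_le\<close> at \<open>u = m / (n + 1)\<close>, multiplied by \<open>\<theta>\<close>. If \<open>\<theta> < 1\<close> and
  \<open>s < \<theta> * critical_exponent \<tau>\<close>, the bound is summable in \<open>m\<close> and \<open>o(2\<^sup>n)\<close> in \<open>n\<close>. The factor
  \<open>2 ^ CARD('n)\<close> pays for rounding the levels to integers.\<close>

lemma overlap_bound_level_le: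
  assumes sum: "(\<Sum>i\<in>UNIV. \<tau> i) > 1" and \<theta>: "0 \<le> \<theta>" "\<theta> \<le> 1"
  shows "2 powr (s * m) * overlap_bound (level \<tau> n) m
    \<le> 2 ^ CARD('n) * 2 powr (\<theta> * (n + 1)) * (2 powr (s - \<theta> * critical_exponent \<tau>)) ^ m"
proof -
  define u where "u = m / (n + 1)"
  define s0 where "s0 = critical_exponent \<tau>"
  have mu: "real m = u * (n + 1)" by (simp add: u_def)
  have "overlap_bound (level \<tau> n) m = (\<Prod>i\<in>UNIV. 2 powr (- max 0 (real m - level \<tau> n i)))"
    unfolding overlap_bound_def
  proof (rule prod.cong[OF refl])
    fix i
    have "(2::real) ^ level \<tau> n i / 2 ^ max m (level \<tau> n i) = 2 powr (real (level \<tau> n i) - real (max m (level \<tau> n i)))"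
      by (simp add: powr_diff powr_realpow)
    also have "real (level \<tau> n i) - real (max m (level \<tau> n i)) = - max 0 (real m - level \<tau> n i)" by (simp add: max_def)
    finally show "(2::real) ^ level \<tau> n i / 2 ^ max m (level \<tau> n i) = 2 powr (- max 0 (real m - level \<tau> n i))" .
  qed
  also have "\<dots> = 2 powr (\<Sum>i\<in>UNIV. - max 0 (real m - level \<tau> n i))" by (simp add: powr_sum)
  finally have ob: "overlap_bound (level \<tau> n) m = 2 powr (\<Sum>i\<in>UNIV. - max 0 (real m - level \<tau> n i))" .
  have "(\<Sum>i\<in>UNIV. - max 0 (real m - level \<tau> n i)) \<le> (\<Sum>i\<in>UNIV. 1 - (n + 1) * max 0 (u - \<tau> i))"
  proof (rule sum_mono)
    fix i
    have "real (level \<tau> n i) \<le> \<tau> i * (n + 1) + 1" 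
    proof -
      have "0 \<le> \<tau> i * (n + 1)" using \<tau>[of i] by simp
      then show ?thesis unfolding level_def by linarith
    qed
    moreover have "real (n + 1) * max 0 (u - \<tau> i) = max 0 (real m - \<tau> i * (n + 1))"
      by (simp add: max_mult_distrib_left mu algebra_simps)
    ultimately show "- max 0 (real m - level \<tau> n i) \<le> 1 - (n + 1) * max 0 (u - \<tau> i)" by linarith
  qed
  also have "\<dots> = real CARD('n) - (n + 1) * excess \<tau> u"
    by (simp add: sum_subtractf excess_def sum_distrib_left)
  finally have "s * m + (\<Sum>i\<in>UNIV. - max 0 (real m - level \<tau> n i)) \<le> s * m + real CARD('n) - (n + 1) * excess \<tau> u"
    by linarith
  also have "\<dots> \<le> s * m + real CARD('n) - (n + 1) * (\<theta> * excess \<tau> u)"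
    using \<theta> excess_nonneg[of \<tau> u] by (intro diff_mono order_refl mult_left_mono) (auto simp: mult_left_le_one_le)
  also have "\<dots> = (s - \<theta> * s0) * m + real CARD('n) + (n + 1) * (\<theta> * (s0 * u - excess \<tau> u))"
    by (simp add: mu algebra_simps)
  also have "\<dots> \<le> (s - \<theta> * s0) * m + real CARD('n) + (n + 1) * (\<theta> * 1)"
    using critical_exponent_mult_le[OF sum, of u] \<theta> by (intro add_left_mono mult_left_mono) (auto simp: s0_def)
  finally have ex: "s * m + (\<Sum>i\<in>UNIV. - max 0 (real m - level \<tau> n i)) \<le> (s - \<theta> * s0) * m + real CARD('n) + \<theta> * (n + 1)"
    by (simp add: mult.commute)
  have "2 powr (s * m) * overlap_bound (level \<tau> n) m = 2 powr (s * m + (\<Sum>i\<in>UNIV. - max 0 (real m - level \<tau> n i)))"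
    by (simp only: ob powr_add)
  also have "\<dots> \<le> 2 powr ((s - \<theta> * s0) * m + real CARD('n) + \<theta> * (n + 1))" using ex by simp
  also have "\<dots> = 2 ^ CARD('n) * 2 powr (\<theta> * (n + 1)) * (2 powr (s - \<theta> * s0)) ^ m"
    by (simp add: powr_add powr_realpow[symmetric] powr_powr)
  finally show ?thesis by (simp add: s0_def add.commute)
qed

end

section \<open>The lower bound\<close>

definition block :: "nat \<Rightarrow> nat set" where
  "block n = {2 ^ n..<2 ^ Suc n}"

lemma block:
  shows "finite (block n)" "block n \<noteq> {}" "card (block n) = 2 ^ n" "k \<in> block n \<Longrightarrow> 1 \<le> k"
proof -
  show "k \<in> block n \<Longrightarrow> 1 \<le> k"
    unfolding block_def by (metis atLeastLessThan_iff one_le_numeral one_le_power order_trans)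
qed (auto simp: block_def)


context
  fixes A :: "nat \<Rightarrow> int ^ 'n ^ 'n" and \<tau> :: "'n::finite \<Rightarrow> real" and s :: real
  assumes det: "\<And>k l. 1 \<le> k \<Longrightarrow> 1 \<le> l \<Longrightarrow> k \<noteq> l \<Longrightarrow> det (A k - A l) \<noteq> 0"
    and \<tau>: "\<And>i. 0 < \<tau> i" and sum: "(\<Sum>i\<in>UNIV. \<tau> i) > 1"
    and s: "0 < s" "s < critical_exponent \<tau>"
begin

text \<open>The square of the dyadic norm, over all levels, of the density of the \<open>n\<close>-th block minus \<open>1\<close>. Here a
  pair \<open>\<omega>\<close> consists of a parameter \<open>\<alpha>\<close> and a shift \<open>x\<close>.\<close>

definition energy :: "nat \<Rightarrow> (real ^ 'n) \<times> (real ^ 'n) \<Rightarrow> ennreal" where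
  "energy n \<omega> = (\<Sum>m. ennreal (2 powr (s * m)) *
     (\<Sum>b\<in>dyadic_indices (\<lambda>_. m). ennreal ((discrepancy A (level \<tau> n) (block n) m b \<omega>)\<^sup>2)))"

lemma energy_measurable [measurable]: "energy n \<in> borel_measurable (cube_measure \<Otimes>\<^sub>M cube_measure)"
proof -
  show ?thesis unfolding energy_def[abs_def] by measurable
qed

text \<open>On each cube the squared error is at most \<open>2\<^sup>-\<^sup>n\<close> times the second moment of a single share.
  Summation over all cubes of level \<open>m\<close> yields \<open>2\<^sup>-\<^sup>n\<close> times \<open>overlap_bound (level \<tau> n) m\<close>, and with
  \<open>\<theta>\<close> strictly between \<open>s / critical_exponent \<tau>\<close> and \<open>1\<close> the sum over \<open>m\<close> is \<open>O(2 powr ((\<theta> - 1) * n))\<close>.\<close>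

lemma nn_integral_energy:
  "\<exists>C q. 0 \<le> C \<and> 0 < q \<and> q < 1 \<and>
    (\<forall>n. (\<integral>\<^sup>+\<omega>. energy n \<omega> \<partial>(cube_measure \<Otimes>\<^sub>M cube_measure)) \<le> ennreal (C * q ^ n))"
proof -
  define s0 where "s0 = critical_exponent \<tau>"
  define t where "t = s / s0"
  define \<theta> where "\<theta> = (1 + t) / 2"
  have s0: "s0 > 0" using s by (simp add: s0_def)
  have t: "0 < t" "t < 1" using s s0 by (auto simp: s0_def t_def)
  then have \<theta>: "0 < \<theta>" "\<theta> < 1" "t < \<theta>" by (auto simp: \<theta>_def)
  define \<rho> where "\<rho> = 2 powr (s - \<theta> * s0)"
  have "s - \<theta> * s0 < 0" using \<theta>(3) s0 by (simp add: t_def divide_less_eq)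
  then have \<rho>: "0 < \<rho>" "\<rho> < 1" using powr_less_mono[of "s - \<theta> * s0" 0 2] by (auto simp: \<rho>_def)
  define q where "q = 2 powr (\<theta> - 1)"
  have q: "0 < q" "q < 1" using powr_less_mono[of "\<theta> - 1" 0 2] \<theta> by (auto simp: q_def)
  define C where "C = 2 ^ CARD('n) * 2 powr \<theta> * (1 / (1 - \<rho>))"
  have "(\<integral>\<^sup>+\<omega>. energy n \<omega> \<partial>(cube_measure \<Otimes>\<^sub>M cube_measure)) \<le> ennreal (C * q ^ n)" for n
  proof -
    define D where "D m = overlap_bound (level \<tau> n) m" for m
    have D0: "0 \<le> D m" for m unfolding D_def overlap_bound_def by (intro prod_nonneg) auto
    have "(\<integral>\<^sup>+\<omega>. energy n \<omega> \<partial>(cube_measure \<Otimes>\<^sub>M cube_measure))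
      = (\<Sum>m. ennreal (2 powr (s * m)) * (\<Sum>b\<in>dyadic_indices (\<lambda>_. m).
          \<integral>\<^sup>+\<omega>. ennreal ((discrepancy A (level \<tau> n) (block n) m b \<omega>)\<^sup>2) \<partial>(cube_measure \<Otimes>\<^sub>M cube_measure)))"
      unfolding energy_def by (subst nn_integral_suminf) (simp_all add: nn_integral_cmult nn_integral_sum del: sum_ennreal)
    also have "\<dots> \<le> (\<Sum>m. ennreal (2 ^ CARD('n) * 2 powr (\<theta> * (n + 1)) / 2 ^ n * \<rho> ^ m))"
    proof (rule suminf_le)
      fix m
      have "(\<Sum>b\<in>dyadic_indices (\<lambda>_. m).
          \<integral>\<^sup>+\<omega>. ennreal ((discrepancy A (level \<tau> n) (block n) m b \<omega>)\<^sup>2) \<partial>(cube_measure \<Otimes>\<^sub>M cube_measure))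
        \<le> (\<Sum>b\<in>dyadic_indices (\<lambda>_::'n. m). ennreal (D m / 2 ^ (m * CARD('n)) / card (block n)))"
        unfolding D_def by (intro sum_mono nn_integral_discrepancy block det) (auto intro: block)
      also have "\<dots> = ennreal (real (card (dyadic_indices (\<lambda>_::'n. m))) * (D m / 2 ^ (m * CARD('n)) / 2 ^ n))"
        using D0[of m] by (subst sum_ennreal) (simp_all add: block(3))
      also have "real (card (dyadic_indices (\<lambda>_::'n. m))) * (D m / 2 ^ (m * CARD('n)) / 2 ^ n) = D m / 2 ^ n"
        by (simp add: card_dyadic_indices power_mult)
      finally have "ennreal (2 powr (s * m)) * (\<Sum>b\<in>dyadic_indices (\<lambda>_. m).
          \<integral>\<^sup>+\<omega>. ennreal ((discrepancy A (level \<tau> n) (block n) m b \<omega>)\<^sup>2) \<partial>(cube_measure \<Otimes>\<^sub>M cube_measure))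
        \<le> ennreal (2 powr (s * m)) * ennreal (D m / 2 ^ n)" by (rule mult_left_mono) simp
      also have "\<dots> = ennreal (2 powr (s * m) * D m / 2 ^ n)" using D0[of m] by (simp add: ennreal_mult[symmetric])
      also have "\<dots> \<le> ennreal (2 ^ CARD('n) * 2 powr (\<theta> * (n + 1)) * \<rho> ^ m / 2 ^ n)"
        using overlap_bound_level_le[OF \<tau> sum, of \<theta> s m n] \<theta>
        by (intro ennreal_leI divide_right_mono) (auto simp: D_def \<rho>_def s0_def add.commute)
      finally show "ennreal (2 powr (s * m)) * (\<Sum>b\<in>dyadic_indices (\<lambda>_. m).
          \<integral>\<^sup>+\<omega>. ennreal ((discrepancy A (level \<tau> n) (block n) m b \<omega>)\<^sup>2) \<partial>(cube_measure \<Otimes>\<^sub>M cube_measure))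
        \<le> ennreal (2 ^ CARD('n) * 2 powr (\<theta> * (n + 1)) / 2 ^ n * \<rho> ^ m)" by simp
    qed auto
    also have "\<dots> = ennreal (\<Sum>m. 2 ^ CARD('n) * 2 powr (\<theta> * (n + 1)) / 2 ^ n * \<rho> ^ m)"
      using \<rho> by (intro suminf_ennreal2 summable_mult summable_geometric) auto
    also have "(\<Sum>m. 2 ^ CARD('n) * 2 powr (\<theta> * (n + 1)) / 2 ^ n * \<rho> ^ m)
        = 2 ^ CARD('n) * 2 powr (\<theta> * (n + 1)) / 2 ^ n * (1 / (1 - \<rho>))"
      using \<rho> by (subst suminf_mult) (auto simp: suminf_geometric)
    also have "\<dots> = C * q ^ n"
    proof -
      have "2 powr (\<theta> * (n + 1)) = 2 powr \<theta> * q ^ n * 2 ^ n"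
        by (simp add: q_def powr_realpow[symmetric] powr_powr algebra_simps flip: powr_add)
      then show ?thesis unfolding C_def by (simp only:) simp
    qed
    finally show ?thesis .
  qed
  moreover have "0 \<le> C" using \<rho> by (simp add: C_def)
  ultimately show ?thesis using q by blast
qed

lemma AE_energy_summable:
  "AE \<alpha> in cube_measure. AE x in cube_measure. (\<Sum>n. energy n (\<alpha>, x)) \<noteq> \<infinity>"
proof -
  interpret C: finite_measure "cube_measure :: (real ^ 'n) measure" by (rule finite_measure_cube_measure)
  interpret P: pair_sigma_finite "cube_measure :: (real ^ 'n) measure" "cube_measure :: (real ^ 'n) measure" ..
  obtain C q where C: "0 \<le> C" and q: "0 < q" "q < 1"
    and le: "\<And>n. (\<integral>\<^sup>+\<omega>. energy n \<omega> \<partial>(cube_measure \<Otimes>\<^sub>M cube_measure)) \<le> ennreal (C * q ^ n)"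
    using nn_integral_energy by blast
  have "(\<integral>\<^sup>+\<omega>. (\<Sum>n. energy n \<omega>) \<partial>(cube_measure \<Otimes>\<^sub>M cube_measure))
      = (\<Sum>n. \<integral>\<^sup>+\<omega>. energy n \<omega> \<partial>(cube_measure \<Otimes>\<^sub>M cube_measure))"
    by (rule nn_integral_suminf) measurable
  also have "\<dots> \<le> (\<Sum>n. ennreal (C * q ^ n))" by (intro suminf_le le) auto
  also have "\<dots> = ennreal (\<Sum>n. C * q ^ n)"
    using C q by (intro suminf_ennreal2 summable_mult summable_geometric) auto
  also have "\<dots> < \<infinity>" by simp
  finally have "AE \<omega> in cube_measure \<Otimes>\<^sub>M cube_measure. (\<Sum>n. energy n \<omega>) \<noteq> \<infinity>"
    by (intro nn_integral_PInf_AE) auto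
  then show ?thesis by (rule P.AE_pair)
qed

lemma dyadic_norm_block_density_le:
  fixes \<omega> :: "(real ^ 'n) \<times> (real ^ 'n)"
  defines "g \<equiv> \<lambda>n z. (\<Sum>k\<in>block n. (\<Prod>i\<in>UNIV. 2 ^ level \<tau> n i) * indicator (torus_box (level \<tau> n) (orbit A k \<omega>)) z) / card (block n)"
  assumes fin: "energy n \<omega> \<noteq> \<infinity>"
  shows "dyadic_norm s L (\<lambda>z. g n z - 1) \<le> sqrt (enn2real (energy n \<omega>))"
proof (rule real_le_rsqrt)
  define V where "V = (\<Prod>i\<in>UNIV. 2 ^ level \<tau> n i :: real)"
  define T where "T k = torus_box (level \<tau> n) (orbit A k \<omega>)" for k
  define dis where "dis m b = discrepancy A (level \<tau> n) (block n) m b \<omega>" for m b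
  have [measurable]: "T k \<in> sets borel" for k by (simp add: T_def torus_box_def)
  have mass: "dyadic_mass (\<lambda>z. g n z - 1) m b = dis m b" for m b
  proof -
    have fin: "emeasure lborel (dyadic_cube m b \<inter> S) < \<infinity>" if "S \<in> sets borel" for S
      by (rule le_less_trans[OF emeasure_mono[of _ "dyadic_cube m b"]]) (auto simp: emeasure_dyadic_box)
    have "indicator (dyadic_cube m b) z * (g n z - 1)
        = (\<Sum>k\<in>block n. V * indicator (dyadic_cube m b \<inter> T k) z) / card (block n) - indicator (dyadic_cube m b \<inter> UNIV) z" for z
      by (auto simp: g_def V_def T_def indicator_def)
    then have "dyadic_mass (\<lambda>z. g n z - 1) m b
        = (\<integral>z. (\<Sum>k\<in>block n. V * indicator (dyadic_cube m b \<inter> T k) z) / card (block n) - indicator (dyadic_cube m b \<inter> UNIV) z \<partial>lborel)"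
      unfolding dyadic_mass_def by (simp only:)
    also have "\<dots> = (\<Sum>k\<in>block n. V * measure lborel (dyadic_cube m b \<inter> T k)) / card (block n) - measure lborel (dyadic_cube m b)"
      using fin[of "T _"] fin[of UNIV]
      by (subst Bochner_Integration.integral_diff)
         (auto intro!: Bochner_Integration.integrable_sum integrable_mult_right integrable_real_indicator simp: Bochner_Integration.integral_sum)
    finally show ?thesis
      by (simp add: dis_def discrepancy_def box_share_def T_def V_def measure_dyadic_box power_divide power_mult)
  qed
  have "(dyadic_norm s L (\<lambda>z. g n z - 1))\<^sup>2
     = (\<Sum>(m,b)\<in>(SIGMA m:{..<L}. dyadic_indices (\<lambda>_::'n. m)). (2 powr (s * m / 2) * dis m b)\<^sup>2)"
    unfolding dyadic_norm_def L2_set_def mass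
    by (subst real_sqrt_pow2) (auto intro!: sum_nonneg simp: case_prod_unfold)
  also have "\<dots> = (\<Sum>m<L. \<Sum>b\<in>dyadic_indices (\<lambda>_::'n. m). (2 powr (s * m / 2) * dis m b)\<^sup>2)"
    by (rule sum.Sigma[symmetric]) auto
  also have "\<dots> = (\<Sum>m<L. 2 powr (s * m) * (\<Sum>b\<in>dyadic_indices (\<lambda>_::'n. m). (dis m b)\<^sup>2))"
    by (simp add: power_mult_distrib power2_eq_square[of "2 powr _"] sum_distrib_left flip: powr_add)
  finally have "ennreal ((dyadic_norm s L (\<lambda>z. g n z - 1))\<^sup>2)
      = (\<Sum>m<L. ennreal (2 powr (s * m)) * (\<Sum>b\<in>dyadic_indices (\<lambda>_::'n. m). ennreal ((dis m b)\<^sup>2)))"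
    by (simp add: sum_nonneg ennreal_mult flip: sum_ennreal)
  also have "\<dots> \<le> energy n \<omega>"
    unfolding energy_def dis_def by (rule sum_le_suminf) auto
  also have "\<dots> = ennreal (enn2real (energy n \<omega>))" using fin by (simp add: less_top)
  finally show "(dyadic_norm s L (\<lambda>z. g n z - 1))\<^sup>2 \<le> enn2real (energy n \<omega>)" by simp
qed

text \<open>Points common to infinitely many blocks of boxes around \<open>x + A k \<alpha>\<close> become points of the limsup set
  after subtraction of \<open>x\<close>. Since the points found lie in the cube from \<open>1/2\<close> to \<open>1\<close> and \<open>x\<close> in the one
  from \<open>0\<close> to \<open>1/2\<close>, the differences stay in the unit cube and this is a genuine translation, without
  reduction modulo \<open>1\<close>.\<close>

lemma shrinking_target_set_pos_of_energy:
  assumes fin: "(\<Sum>n. energy n (\<alpha>, x)) \<noteq> \<infinity>" and x: "\<And>i. 0 < x $ i \<and> x $ i < 1/2"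
    and r: "\<And>i n. 1 \<le> n \<Longrightarrow> r i n = real n powr (- \<tau> i)"
  shows "hausdorff_measure s (shrinking_target_set \<alpha> A r) \<noteq> 0"
proof
  assume null: "hausdorff_measure s (shrinking_target_set \<alpha> A r) = 0"
  define \<omega> where "\<omega> = (\<alpha>, x)"
  define p where "p = level \<tau>"
  define V where "V n = (\<Prod>i\<in>UNIV. 2 ^ p n i :: real)" for n
  define T where "T n k = torus_box (p n) (orbit A k \<omega>)" for n k
  define g where "g n z = (\<Sum>k\<in>block n. V n * indicator (T n k) z) / card (block n)" for n z
  define E where "E n = (\<Union>k\<in>block n. cbox (\<chi> i. frac (orbit A k \<omega> $ i) - (1/2) ^ p n i) (\<chi> i. frac (orbit A k \<omega> $ i) + (1/2) ^ p n i))" for n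
  have en: "energy n \<omega> \<noteq> \<infinity>" for n
  proof -
    have "energy n \<omega> \<le> (\<Sum>n. energy n \<omega>)"
      using sum_le_suminf[of "\<lambda>n. energy n \<omega>" "{n}"] by simp
    then show ?thesis using fin by (auto simp: \<omega>_def top.extremum_unique)
  qed
  define \<delta> where "\<delta> = (\<lambda>n. sqrt (enn2real (energy n \<omega>)))"
  have "(\<Sum>n. ennreal (enn2real (energy n \<omega>))) \<noteq> \<infinity>"
    using fin en by (simp add: \<omega>_def less_top)
  then have "summable (\<lambda>n. enn2real (energy n \<omega>))"
    by (intro summable_suminf_not_top) auto
  from tendsto_real_sqrt[OF summable_LIMSEQ_zero[OF this]] have \<delta>: "\<delta> \<longlonglongrightarrow> 0" by (simp add: \<delta>_def)
  have s_dim: "s < CARD('n)" using s critical_exponent_less_dim[OF \<tau> sum] by simp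
  have nn: "0 \<le> g n z" for n z
    unfolding g_def V_def by (intro divide_nonneg_nonneg sum_nonneg mult_nonneg_nonneg prod_nonneg) auto
  have bb: "bounded_borel (g n)" for n
  proof -
    have meas: "g n \<in> borel_measurable borel" unfolding g_def T_def torus_box_def by measurable
    have "\<bar>g n z\<bar> \<le> (\<Sum>k\<in>block n. V n) / card (block n)" for z
    proof -
      have "g n z \<le> (\<Sum>k\<in>block n. V n) / card (block n)"
        unfolding g_def by (intro divide_right_mono sum_mono) (auto simp: V_def prod_nonneg indicator_def)
      then show ?thesis using nn[of n z] by simp
    qed
    with meas show ?thesis by (auto simp: bounded_borel_def)
  qed
  have step: "\<exists>M. dyadic_step M (g n)" for n
  proof (intro exI[of _ "Max (range (p n))"], unfold dyadic_step_def, intro allI impI)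
    fix y z :: "real ^ 'n"
    assume "dyadic_index (\<lambda>_. Max (range (p n))) y = dyadic_index (\<lambda>_. Max (range (p n))) z"
    then have "dyadic_index (p n) y = dyadic_index (p n) z"
      by (rule dyadic_index_coarsen[rotated]) simp
    then show "g n y = g n z" by (simp add: g_def T_def torus_box_def indicator_def mem_dyadic_box_iff)
  qed
  have supp: "z \<in> E n" if "g n z \<noteq> 0" for n z
  proof -
    have "\<exists>k\<in>block n. z \<in> T n k"
    proof (rule ccontr)
      assume "\<not> ?thesis"
      then have "g n z = 0" by (simp add: g_def)
      with that show False by simp
    qed
    then obtain k where k: "k \<in> block n" "z \<in> T n k" by blast
    have "\<bar>z $ i - frac (orbit A k \<omega> $ i)\<bar> \<le> (1/2) ^ p n i" for i
    proof -
      have "\<lfloor>2 ^ p n i * z $ i\<rfloor> = \<lfloor>2 ^ p n i * frac (orbit A k \<omega> $ i)\<rfloor>"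
        using k(2) by (simp add: T_def torus_box_def mem_dyadic_box_iff dyadic_index_def frac_vec_def fun_eq_iff)
      then have "\<bar>2 ^ p n i * z $ i - 2 ^ p n i * frac (orbit A k \<omega> $ i)\<bar> \<le> 1" by linarith
      then have "2 ^ p n i * \<bar>z $ i - frac (orbit A k \<omega> $ i)\<bar> \<le> 1"
        by (simp add: abs_mult flip: right_diff_distrib)
      then show ?thesis by (simp add: power_divide field_simps)
    qed
    then have "z \<in> cbox (\<chi> i. frac (orbit A k \<omega> $ i) - (1/2) ^ p n i) (\<chi> i. frac (orbit A k \<omega> $ i) + (1/2) ^ p n i)"
      by (simp add: mem_box_cart abs_le_iff algebra_simps)
    with k(1) show ?thesis unfolding E_def by blast
  qed
  have norm: "dyadic_norm s L (\<lambda>z. g n z - 1) \<le> \<delta> n" for n L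
    using dyadic_norm_block_density_le[OF en, of L n] by (simp add: g_def[abs_def] \<delta>_def V_def T_def p_def)
  have closed: "closed (E n)" for n
    unfolding E_def by (intro closed_UN block(1) ballI closed_cbox)
  obtain \<iota> :: "nat \<Rightarrow> nat" where \<iota>: "strict_mono \<iota>"
    "hausdorff_measure s (cbox (\<chi> i. 1/2) (\<chi> i. 1) \<inter> (\<Inter>j. E (\<iota> j))) \<noteq> 0"
    by (rule hausdorff_measure_intersection_pos[of s g E \<delta>, OF s(1) s_dim bb nn step supp closed norm \<delta>]) blast
  have "z - x \<in> shrinking_target_set \<alpha> A r"
    if z: "z \<in> cbox (\<chi> i. 1/2) (\<chi> i. 1)" "\<And>j. z \<in> E (\<iota> j)" for z
    unfolding mem_shrinking_target_set_iff
  proof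
    have "1/2 \<le> z $ i \<and> z $ i \<le> 1" for i using z(1) by (simp add: mem_box_cart)
    then have "0 \<le> z $ i - x $ i \<and> z $ i - x $ i < 1" for i using x[of i] by (smt (verit))
    then show "z - x \<in> unit_cube" by (simp add: unit_cube_def)
    show "infinite {n. 1 \<le> n \<and> (\<forall>i. dist_nearest_int (int_mat_apply (A n) \<alpha> $ i - (z - x) $ i) \<le> r i n)}"
      unfolding infinite_nat_iff_unbounded_le
    proof
      fix N
      obtain k where k: "k \<in> block (\<iota> N)"
        and zk: "z \<in> cbox (\<chi> i. frac (orbit A k \<omega> $ i) - (1/2) ^ p (\<iota> N) i) (\<chi> i. frac (orbit A k \<omega> $ i) + (1/2) ^ p (\<iota> N) i)"
        using z(2)[of N] unfolding E_def by blast
      have "N \<le> \<iota> N" using \<iota>(1) by (rule strict_mono_imp_increasing)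
      also have "\<dots> \<le> 2 ^ \<iota> N" by (rule less_imp_le[OF less_exp])
      also have "\<dots> \<le> k" using k by (simp add: block_def)
      finally have "N \<le> k" .
      moreover have k1: "1 \<le> k" by (rule block(4)[OF k])
      moreover have "dist_nearest_int (int_mat_apply (A k) \<alpha> $ i - (z - x) $ i) \<le> r i k" for i
      proof -
        define y where "y = orbit A k \<omega> $ i"
        have y: "y = x $ i + int_mat_apply (A k) \<alpha> $ i" by (simp add: y_def orbit_def \<omega>_def)
        have "\<bar>frac y - z $ i\<bar> \<le> (1/2) ^ p (\<iota> N) i"
          using zk unfolding y_def by (simp add: mem_box_cart abs_le_iff algebra_simps)
        also have "\<dots> = 2 powr (- real (p (\<iota> N) i))"
          by (simp add: powr_minus powr_realpow power_divide inverse_eq_divide)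
        also have "\<dots> \<le> 2 powr (- (\<tau> i * (\<iota> N + 1)))"
          unfolding p_def level_def by (intro powr_mono) (auto, linarith)
        also have "\<dots> = (2 powr (real (\<iota> N + 1))) powr (- \<tau> i)" by (simp add: powr_powr mult.commute)
        also have "\<dots> \<le> real k powr (- \<tau> i)"
        proof (rule powr_mono2')
          have "k \<le> 2 ^ (\<iota> N + 1)" using k by (simp add: block_def)
          then have "real k \<le> 2 ^ (\<iota> N + 1)" by (metis of_nat_le_iff of_nat_numeral of_nat_power)
          then show "real k \<le> 2 powr (real (\<iota> N + 1))" by (subst powr_realpow) auto
        qed (use k1 \<tau>[of i] in auto)
        finally have "\<bar>frac y - z $ i\<bar> \<le> r i k" by (simp add: r[OF k1])
        then show ?thesis unfolding dist_nearest_int_le_iff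
          by (intro exI[of _ "\<lfloor>y\<rfloor>"]) (simp add: frac_def y algebra_simps)
      qed
      ultimately show "\<exists>n\<ge>N. n \<in> {n. 1 \<le> n \<and> (\<forall>i. dist_nearest_int (int_mat_apply (A n) \<alpha> $ i - (z - x) $ i) \<le> r i n)}"
        by blast
    qed
  qed
  then have "cbox (\<chi> i. 1/2) (\<chi> i. 1) \<inter> (\<Inter>j. E (\<iota> j)) \<subseteq> (+) x ` shrinking_target_set \<alpha> A r"
    by (intro subsetI image_eqI[of _ _ "_ - x"]) auto
  with hausdorff_measure_null_translation[OF null, of x] \<iota>(2) show False
    using hausdorff_measure_null_subset by blast
qed

text \<open>For almost all \<open>\<alpha>\<close> the energies are summable for almost all shifts, hence for some shift in the small
  cube \<open>B\<close>, which has positive measure.\<close>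

lemma AE_shrinking_target_set_pos:
  assumes r: "\<And>i n. 1 \<le> n \<Longrightarrow> r i n = real n powr (- \<tau> i)"
  shows "AE \<alpha> in lborel. \<alpha> \<in> unit_cube \<longrightarrow> hausdorff_measure s (shrinking_target_set \<alpha> A r) \<noteq> 0"
proof -
  have "AE \<alpha> in cube_measure. hausdorff_measure s (shrinking_target_set \<alpha> A r) \<noteq> 0"
    using AE_energy_summable
  proof (rule AE_mp, intro AE_I2 impI)
    fix \<alpha> :: "real ^ 'n"
    assume ae: "AE x in cube_measure. (\<Sum>n. energy n (\<alpha>, x)) \<noteq> \<infinity>"
    define B where "B = {x :: real ^ 'n. \<forall>i. (\<chi> i. 1/4) $ i \<le> x $ i \<and> x $ i < (\<chi> i. 1/2) $ i}"
    have B: "0 < x $ i" "x $ i < 1/2" if "x \<in> B" for x i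
    proof -
      have "1/4 \<le> x $ i" "x $ i < 1/2" using that by (auto simp: B_def)
      then show "0 < x $ i" "x $ i < 1/2" by linarith+
    qed
    have [measurable]: "B \<in> sets borel" unfolding B_def by measurable
    have "\<exists>x\<in>B. (\<Sum>n. energy n (\<alpha>, x)) \<noteq> \<infinity>"
    proof (rule ccontr)
      assume no: "\<not> ?thesis"
      have "AE x in lborel. x \<in> unit_cube \<longrightarrow> (\<Sum>n. energy n (\<alpha>, x)) \<noteq> \<infinity>"
        using ae unfolding cube_measure_def by (subst (asm) AE_restrict_space_iff) auto
      then have "AE x in lborel. x \<notin> B"
      proof (rule AE_mp, intro AE_I2 impI)
        fix x assume *: "x \<in> unit_cube \<longrightarrow> (\<Sum>n. energy n (\<alpha>, x)) \<noteq> \<infinity>"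
        show "x \<notin> B"
        proof
          assume x: "x \<in> B"
          have "0 \<le> x $ i \<and> x $ i < 1" for i
          proof -
            have "0 < x $ i" "x $ i < 1/2" using B[OF x] by auto
            then show ?thesis by simp
          qed
          then have "x \<in> unit_cube" by (simp add: unit_cube_def)
          with * no x show False by blast
        qed
      qed
      then have "emeasure lborel B = 0"
        by (subst (asm) AE_iff_measurable[of B]) auto
      moreover have "emeasure lborel B = ennreal (\<Prod>i\<in>(UNIV :: 'n set). 1/4)"
        unfolding B_def by (subst emeasure_half_open_box) auto
      ultimately show False by simp
    qed
    then obtain x where "x \<in> B" "(\<Sum>n. energy n (\<alpha>, x)) \<noteq> \<infinity>" by blast
    then show "hausdorff_measure s (shrinking_target_set \<alpha> A r) \<noteq> 0"
      using shrinking_target_set_pos_of_energy[OF _ _ r] B by blast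
  qed
  then show ?thesis unfolding cube_measure_def by (subst (asm) AE_restrict_space_iff) auto
qed

end

section \<open>The dimension\<close>

lemma hausdorff_dim_eqI:
  assumes d: "0 \<le> d"
    and upper: "\<And>t. d < t \<Longrightarrow> hausdorff_measure t E = 0"
    and lower: "\<And>t. 0 \<le> t \<Longrightarrow> t < d \<Longrightarrow> hausdorff_measure t E \<noteq> 0"
  shows "hausdorff_dim E = ereal d"
proof (rule antisym)
  show "hausdorff_dim E \<le> ereal d"
  proof (rule ereal_le_epsilon2)
    fix e :: real assume "0 < e"
    then have "ereal (d + e) \<in> {ereal s | s. 0 \<le> s \<and> hausdorff_measure s E = 0}"
      using upper[of "d + e"] d by auto
    then have "hausdorff_dim E \<le> ereal (d + e)"
      unfolding hausdorff_dim_def by (rule Inf_lower)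
    then show "hausdorff_dim E \<le> ereal d + ereal e" by simp
  qed
  show "ereal d \<le> hausdorff_dim E"
    unfolding hausdorff_dim_def
  proof (rule Inf_greatest, clarify)
    fix t assume "0 \<le> t" "hausdorff_measure t E = 0"
    then have "\<not> t < d" using lower by blast
    then show "ereal d \<le> ereal t" by simp
  qed
qed

theorem corollary12:
  fixes A :: "nat \<Rightarrow> int ^ 'n ^ 'n"
    and \<tau> :: "'n::finite \<Rightarrow> real"
    and r :: "'n \<Rightarrow> nat \<Rightarrow> real"
  assumes "\<And>m n. 1 \<le> m \<Longrightarrow> 1 \<le> n \<Longrightarrow> m \<noteq> n \<Longrightarrow> det (A m - A n) \<noteq> 0"
    and "\<And>i. 0 < \<tau> i"
    and "(\<Sum>i\<in>UNIV. \<tau> i) > 1"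
    and "\<And>i n. 1 \<le> n \<Longrightarrow> r i n = real n powr (- \<tau> i)"
  shows "AE \<alpha> in lebesgue. \<alpha> \<in> unit_cube \<longrightarrow>
    hausdorff_dim (shrinking_target_set \<alpha> A r) =
      ereal (MIN i\<in>UNIV. (1 + (\<Sum>j | \<tau> j < \<tau> i. \<tau> i - \<tau> j)) / \<tau> i)"
proof -
  define s0 where "s0 = critical_exponent \<tau>"
  have s0: "0 < s0" unfolding s0_def by (rule critical_exponent_pos[OF assms(2)])
  obtain i where i: "s0 = (1 + (\<Sum>j | \<tau> j < \<tau> i. \<tau> i - \<tau> j)) / \<tau> i"
    using critical_exponent_attained[of \<tau>, OF assms(2)] by (auto simp: s0_def excess_eq)
  define \<sigma> where "\<sigma> k = s0 * (1 - 1 / (real k + 2))" for k :: nat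
  have \<sigma>: "0 < \<sigma> k" "\<sigma> k < s0" for k
    using s0 by (auto simp: \<sigma>_def)
  have "AE \<alpha> in lborel. \<forall>k. \<alpha> \<in> unit_cube \<longrightarrow> hausdorff_measure (\<sigma> k) (shrinking_target_set \<alpha> A r) \<noteq> 0"
    unfolding AE_all_countable
    using AE_shrinking_target_set_pos[OF assms(1-3) _ _ assms(4)] \<sigma> by (auto simp: s0_def)
  then have "AE \<alpha> in lborel. \<alpha> \<in> unit_cube \<longrightarrow> hausdorff_dim (shrinking_target_set \<alpha> A r) = ereal s0"
  proof (rule AE_mp, intro AE_I2 impI)
    fix \<alpha> :: "real ^ 'n"
    assume pos: "\<forall>k. \<alpha> \<in> unit_cube \<longrightarrow> hausdorff_measure (\<sigma> k) (shrinking_target_set \<alpha> A r) \<noteq> 0"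
      and \<alpha>: "\<alpha> \<in> unit_cube"
    show "hausdorff_dim (shrinking_target_set \<alpha> A r) = ereal s0"
    proof (rule hausdorff_dim_eqI)
      show "hausdorff_measure t (shrinking_target_set \<alpha> A r) = 0" if "s0 < t" for t

      proof (rule shrinking_target_set_null[OF assms(2)])
        show "(1 + (\<Sum>j | \<tau> j < \<tau> i. \<tau> i - \<tau> j)) / \<tau> i < t" using that i by simp
      qed (rule assms(4))
      show "hausdorff_measure t (shrinking_target_set \<alpha> A r) \<noteq> 0" if t: "0 \<le> t" "t < s0" for t
      proof -
        have "\<sigma> = (\<lambda>k. s0 * (1 + - inverse (real (Suc (Suc k)))))"
          by (auto simp: \<sigma>_def fun_eq_iff inverse_eq_divide add_ac)
        then have "\<sigma> \<longlonglongrightarrow> s0"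
          using LIMSEQ_Suc[OF LIMSEQ_inverse_real_of_nat_add_minus_mult, of s0] by simp
        then have "\<forall>\<^sub>F k in sequentially. t < \<sigma> k" using t(2) by (intro order_tendstoD) auto
        then obtain k where "t < \<sigma> k" by (auto simp: eventually_sequentially)
        then show ?thesis using pos \<alpha> hausdorff_measure_null_mono[of t "\<sigma> k"] t(1) by auto
      qed
    qed (use s0 in simp)
  qed
  then show ?thesis unfolding s0_def critical_exponent_def by (rule AE_completion)
qed
end
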